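(* Let $X$ be a smooth manifold, possibly with boundary, with interior $X^\circ$, endowed with a fixed positive smooth density $d\mu$, and let $\omega\subset X^\circ$ be a non-empty open set. (i) Let $E\subset L^2(X)$ be a finite-dimensional subspace with $\dim E\ge 2$ and set $E_\omega:=\{u|_\omega: u\in E\}\subset L^2(\omega)$. Then there exists $\sigma\in C_c^\infty(\omega,\mathbb R)$ such that $(P_EM_\sigma)|_E\notin\mathbb R I_E$ if and only if $E_\omega\ne\{0\}$. (ii) Let $\mathcal Q$ be an admissible perturbation space on $X$ with $C_c^\infty(\omega,\mathbb R)\subset\mathcal Q$, let $L$ be a self-adjoint operator on $L^2(X)$, let $q\in\mathcal Q$, $L_q:=L+M_q$, and let $\lambda$ be an eigenvalue of $L_q$ whose eigenspace $E_q:=\ker(L_q-\lambda I)$ satisfies $2\le\dim E_q<\infty$. If $\{u|_\omega:u\in E_q\}\neq\{0\}$, then there exists $\sigma\in C_c^\infty(\omega,\mathbb R)\subset\mathcal Q$ with $(P_{E_q}M_\sigma)|_{E_q}\notin\mathbb R I_{E_q}$. In particular, such a $\sigma$ exists whenever the following weak unique-continuation property from $\omega$ holds: every $u\in\ker(L_q-\lambda I)$ with $u=0$ a.e. on $\omega$ satisfies $u=0$ a.e. on $X$.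
   Context: $L^2(X):=L^2(X,\mathbb C;d\mu)$. $M_\sigma$ denotes multiplication by $\sigma$ and $P_E$ the orthogonal projection of $L^2(X)$ onto $E$. An admissible perturbation space on $X$ is a real Fréchet space $\mathcal Q$ together with a continuous injective linear map $\mathcal Q\to L^\infty(X,\mathbb R)$, and elements of $\mathcal Q$ are identified with their images in $L^\infty(X,\mathbb R)$. *)

theory Defs
  imports "HOL-Analysis.Analysis" "HOL-Probability.Essential_Supremum"
begin

section \<open>Smooth functions on subsets of Euclidean space\<close>

primrec times_differentiable_on ::
  "nat \<Rightarrow> 'b::real_normed_vector set \<Rightarrow> ('b \<Rightarrow> 'c::real_normed_vector) \<Rightarrow> bool" where
  "times_differentiable_on 0 V f \<longleftrightarrow> continuous_on V f"
| "times_differentiable_on (Suc k) V f \<longleftrightarrow>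
     (\<forall>x\<in>V. f differentiable (at x)) \<and>
     (\<forall>v. times_differentiable_on k V (\<lambda>x. frechet_derivative f (at x) v))"

text \<open>As usual for domains that are not open (such as open subsets of a half-space), smoothness
  means that there are local smooth extensions to open sets of the ambient space.\<close>

definition smooth_on ::
  "'b::real_normed_vector set \<Rightarrow> ('b \<Rightarrow> 'c::real_normed_vector) \<Rightarrow> bool" where
  "smooth_on S f \<longleftrightarrow>
     (\<forall>x\<in>S. \<exists>V g. open V \<and> x \<in> V \<and> (\<forall>k. times_differentiable_on k V g) \<and>
                  (\<forall>y\<in>V \<inter> S. g y = f y))"


section \<open>Smooth manifolds with boundary\<close>

text \<open>
  The manifold \<open>X\<close> is the whole type \<open>'a\<close>, which carries a second countable Hausdorff topology.
  The model space is \<open>\<real>\<^sup>n = span B\<close> for a set \<open>B\<close> of \<open>n\<close> standard basis vectors of a Euclidean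
  space type \<open>'b\<close>. Taking \<open>B = Basis\<close> gives \<open>\<real>\<^sup>n = UNIV\<close>; the point of allowing other \<open>B\<close> is that
  \<open>B = {}\<close> gives dimension \<open>0\<close>, which no Euclidean space type has.
  A chart is a pair of its domain and the coordinate map, only relevant on the domain.
\<close>

type_synonym ('a, 'b) chart = "'a set \<times> ('a \<Rightarrow> 'b)"

definition half_space :: "'b::euclidean_space set \<Rightarrow> 'b \<Rightarrow> 'b set" where
  "half_space B e = {x \<in> span B. 0 \<le> x \<bullet> e}"

definition is_chart :: "'b::euclidean_space set \<Rightarrow> ('a::topological_space, 'b) chart \<Rightarrow> bool" where
  "is_chart B = (\<lambda>(U, \<phi>). open U \<and> homeomorphism U (\<phi> ` U) \<phi> (inv_into U \<phi>) \<and>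
     (openin (top_of_set (span B)) (\<phi> ` U) \<or>
      (\<exists>e\<in>B. openin (top_of_set (half_space B e)) (\<phi> ` U))))"

definition smooth_manifold ::
  "'b::euclidean_space set \<Rightarrow> ('a::{t2_space, second_countable_topology}, 'b) chart set \<Rightarrow> bool" where
  "smooth_manifold B \<A> \<longleftrightarrow> B \<subseteq> Basis \<and> (\<forall>c\<in>\<A>. is_chart B c) \<and> (\<Union>(U, \<phi>)\<in>\<A>. U) = UNIV \<and>
     (\<forall>(U, \<phi>)\<in>\<A>. \<forall>(U', \<phi>')\<in>\<A>. smooth_on (\<phi> ` (U \<inter> U')) (\<phi>' \<circ> inv_into U \<phi>))"

definition manifold_interior ::
  "'b::euclidean_space set \<Rightarrow> ('a::topological_space, 'b) chart set \<Rightarrow> 'a set" where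
  "manifold_interior B \<A> =
     {x. \<exists>(U, \<phi>)\<in>\<A>. x \<in> U \<and> \<phi> x \<in> top_of_set (span B) interior_of (\<phi> ` U)}"

text \<open>The space \<open>C\<^sub>c\<^sup>\<infinity>(\<omega>, \<real>)\<close>, its elements being extended by zero outside \<open>\<omega>\<close>.\<close>

definition Cc_smooth ::
  "('a::topological_space, 'b::euclidean_space) chart set \<Rightarrow> 'a set \<Rightarrow> ('a \<Rightarrow> real) set" where
  "Cc_smooth \<A> \<omega> =
     {\<sigma>. (\<forall>(U, \<phi>)\<in>\<A>. smooth_on (\<phi> ` U) (\<sigma> \<circ> inv_into U \<phi>)) \<and>
         compact (closure {x. \<sigma> x \<noteq> 0}) \<and> closure {x. \<sigma> x \<noteq> 0} \<subseteq> \<omega>}"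

text \<open>Lebesgue measure on \<open>span B\<close>, regarded as a measure on the ambient space.\<close>

definition lebesgue_span :: "'b::euclidean_space set \<Rightarrow> 'b measure" where
  "lebesgue_span B = distr (\<Pi>\<^sub>M b\<in>B. lborel) borel (\<lambda>f. \<Sum>b\<in>B. f b *\<^sub>R b)"

lemma lebesgue_span_Basis: "lebesgue_span Basis = lborel"
  unfolding lebesgue_span_def by (rule lborel_eq[symmetric])

text \<open>A positive smooth density is identified with the Borel measure it defines.\<close>

definition positive_smooth_density ::
  "'b::euclidean_space set \<Rightarrow> ('a::topological_space, 'b) chart set \<Rightarrow> 'a measure \<Rightarrow> bool" where
  "positive_smooth_density B \<A> \<mu> \<longleftrightarrow> sets \<mu> = sets borel \<and>
     (\<forall>(U, \<phi>)\<in>\<A>. \<exists>h :: 'b \<Rightarrow> real. smooth_on (\<phi> ` U) h \<and> (\<forall>y\<in>\<phi> ` U. 0 < h y) \<and>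
        (\<forall>S\<in>sets borel. S \<subseteq> \<phi> ` U \<longrightarrow>
           emeasure \<mu> {x \<in> U. \<phi> x \<in> S} = (\<integral>\<^sup>+y\<in>S. ennreal (h y) \<partial>lebesgue_span B)))"


section \<open>The Hilbert space of square-integrable functions\<close>

text \<open>
  Elements of \<open>L\<^sup>2\<close> are represented by square-integrable functions, equality being equality almost
  everywhere. Subsets of \<open>L\<^sup>2\<close> are represented by sets of functions that are closed under
  almost everywhere equality, i.e. by the unions of the corresponding sets of classes.
\<close>

definition L2 :: "'a measure \<Rightarrow> ('a \<Rightarrow> complex) set" where
  "L2 M = {f \<in> borel_measurable M. integrable M (\<lambda>x. (cmod (f x))\<^sup>2)}"

definition L2_inner :: "'a measure \<Rightarrow> ('a \<Rightarrow> complex) \<Rightarrow> ('a \<Rightarrow> complex) \<Rightarrow> complex" where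
  "L2_inner M f g = (\<integral>x. f x * cnj (g x) \<partial>M)"

definition L2_norm :: "'a measure \<Rightarrow> ('a \<Rightarrow> complex) \<Rightarrow> real" where
  "L2_norm M f = sqrt (\<integral>x. (cmod (f x))\<^sup>2 \<partial>M)"

definition L2_zero :: "'a measure \<Rightarrow> ('a \<Rightarrow> complex) set" where
  "L2_zero M = {f \<in> L2 M. AE x in M. f x = 0}"

definition L2_subspace :: "'a measure \<Rightarrow> ('a \<Rightarrow> complex) set \<Rightarrow> bool" where
  "L2_subspace M E \<longleftrightarrow> E \<subseteq> L2 M \<and> (\<lambda>x. 0) \<in> E \<and>
     (\<forall>f\<in>E. \<forall>g\<in>E. (\<lambda>x. f x + g x) \<in> E) \<and> (\<forall>c. \<forall>f\<in>E. (\<lambda>x. c * f x) \<in> E) \<and>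
     (\<forall>f\<in>E. \<forall>g\<in>L2 M. (AE x in M. g x = f x) \<longrightarrow> g \<in> E)"

definition L2_has_dim :: "'a measure \<Rightarrow> ('a \<Rightarrow> complex) set \<Rightarrow> nat \<Rightarrow> bool" where
  "L2_has_dim M E n \<longleftrightarrow> (\<exists>b. (\<forall>i<n. b i \<in> E) \<and>
     (\<forall>u\<in>E. \<exists>c. AE x in M. u x = (\<Sum>i<n. c i * b i x)) \<and>
     (\<forall>c. (AE x in M. (\<Sum>i<n. c i * b i x) = 0) \<longrightarrow> (\<forall>i<n. c i = 0)))"

text \<open>The set of restrictions \<open>E\<^sub>\<omega> = {u|\<^sub>\<omega>. u \<in> E}\<close> as a subset of \<open>L\<^sup>2(\<omega>)\<close>.\<close>

definition L2_restrict ::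
  "'a measure \<Rightarrow> 'a set \<Rightarrow> ('a \<Rightarrow> complex) set \<Rightarrow> ('a \<Rightarrow> complex) set" where
  "L2_restrict M \<omega> E =
     {v \<in> L2 (restrict_space M \<omega>). \<exists>u\<in>E. AE x in restrict_space M \<omega>. v x = u x}"

text \<open>The orthogonal projection onto \<open>E\<close>; the choice is only between representatives of one class.\<close>

definition L2_proj ::
  "'a measure \<Rightarrow> ('a \<Rightarrow> complex) set \<Rightarrow> ('a \<Rightarrow> complex) \<Rightarrow> 'a \<Rightarrow> complex" where
  "L2_proj M E f = (SOME p. p \<in> E \<and> (\<forall>v\<in>E. L2_inner M (\<lambda>x. f x - p x) v = 0))"

definition mult_op :: "('a \<Rightarrow> real) \<Rightarrow> ('a \<Rightarrow> complex) \<Rightarrow> 'a \<Rightarrow> complex" where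
  "mult_op \<sigma> u = (\<lambda>x. complex_of_real (\<sigma> x) * u x)"

definition real_scalar_on ::
  "'a measure \<Rightarrow> ('a \<Rightarrow> complex) set \<Rightarrow> (('a \<Rightarrow> complex) \<Rightarrow> 'a \<Rightarrow> complex) \<Rightarrow> bool" where
  "real_scalar_on M E T \<longleftrightarrow> (\<exists>c::real. \<forall>u\<in>E. AE x in M. T u x = complex_of_real c * u x)"


section \<open>Self-adjoint operators\<close>

text \<open>A possibly unbounded operator on \<open>L\<^sup>2\<close> is given by its domain \<open>D\<close> and a map \<open>L\<close>, only
  relevant on \<open>D\<close>, that is compatible with almost everywhere equality.\<close>

definition L2_operator ::
  "'a measure \<Rightarrow> ('a \<Rightarrow> complex) set \<Rightarrow> (('a \<Rightarrow> complex) \<Rightarrow> 'a \<Rightarrow> complex) \<Rightarrow> bool" where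
  "L2_operator M D L \<longleftrightarrow> L2_subspace M D \<and> (\<forall>u\<in>D. L u \<in> L2 M) \<and>
     (\<forall>u\<in>D. \<forall>v\<in>D. (AE x in M. u x = v x) \<longrightarrow> (AE x in M. L u x = L v x)) \<and>
     (\<forall>u\<in>D. \<forall>v\<in>D. AE x in M. L (\<lambda>x. u x + v x) x = L u x + L v x) \<and>
     (\<forall>c. \<forall>u\<in>D. AE x in M. L (\<lambda>x. c * u x) x = c * L u x)"

definition L2_dense :: "'a measure \<Rightarrow> ('a \<Rightarrow> complex) set \<Rightarrow> bool" where
  "L2_dense M D \<longleftrightarrow> (\<forall>f\<in>L2 M. \<forall>\<epsilon>>0. \<exists>g\<in>D. L2_norm M (\<lambda>x. f x - g x) < \<epsilon>)"

definition op_graph ::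
  "'a measure \<Rightarrow> ('a \<Rightarrow> complex) set \<Rightarrow> (('a \<Rightarrow> complex) \<Rightarrow> 'a \<Rightarrow> complex) \<Rightarrow>
   (('a \<Rightarrow> complex) \<times> ('a \<Rightarrow> complex)) set" where
  "op_graph M D L = {(v, w). v \<in> D \<and> w \<in> L2 M \<and> (AE x in M. w x = L v x)}"

definition adjoint_graph ::
  "'a measure \<Rightarrow> ('a \<Rightarrow> complex) set \<Rightarrow> (('a \<Rightarrow> complex) \<Rightarrow> 'a \<Rightarrow> complex) \<Rightarrow>
   (('a \<Rightarrow> complex) \<times> ('a \<Rightarrow> complex)) set" where
  "adjoint_graph M D L =
     {(v, w). v \<in> L2 M \<and> w \<in> L2 M \<and> (\<forall>u\<in>D. L2_inner M (L u) v = L2_inner M u w)}"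

definition self_adjoint ::
  "'a measure \<Rightarrow> ('a \<Rightarrow> complex) set \<Rightarrow> (('a \<Rightarrow> complex) \<Rightarrow> 'a \<Rightarrow> complex) \<Rightarrow> bool" where
  "self_adjoint M D L \<longleftrightarrow> L2_operator M D L \<and> L2_dense M D \<and> adjoint_graph M D L = op_graph M D L"

text \<open>The operator \<open>L + M\<^sub>f\<close>; as \<open>f\<close> will be bounded, it has the same domain as \<open>L\<close>.\<close>

definition perturbed ::
  "(('a \<Rightarrow> complex) \<Rightarrow> 'a \<Rightarrow> complex) \<Rightarrow> ('a \<Rightarrow> real) \<Rightarrow> ('a \<Rightarrow> complex) \<Rightarrow> 'a \<Rightarrow> complex" where
  "perturbed L f u = (\<lambda>x. L u x + mult_op f u x)"

definition eigenspace ::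
  "'a measure \<Rightarrow> ('a \<Rightarrow> complex) set \<Rightarrow> (('a \<Rightarrow> complex) \<Rightarrow> 'a \<Rightarrow> complex) \<Rightarrow> complex \<Rightarrow>
   ('a \<Rightarrow> complex) set" where
  "eigenspace M D T z = {u \<in> D. AE x in M. T u x - z * u x = 0}"


section \<open>Admissible perturbation spaces\<close>

definition Linf :: "'a measure \<Rightarrow> ('a \<Rightarrow> real) set" where
  "Linf M = {f \<in> borel_measurable M. esssup M (\<lambda>x. ereal \<bar>f x\<bar>) < \<infinity>}"

definition seminorm :: "('q::real_vector \<Rightarrow> real) \<Rightarrow> bool" where
  "seminorm p \<longleftrightarrow> (\<forall>x. 0 \<le> p x) \<and> (\<forall>x y. p (x + y) \<le> p x + p y) \<and> (\<forall>c x. p (c *\<^sub>R x) = \<bar>c\<bar> * p x)"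

text \<open>The topology is generated by a countable separating family of seminorms and is complete;
  by metrizability, completeness may be expressed by sequences.\<close>

definition frechet_space :: "'q::real_vector topology \<Rightarrow> bool" where
  "frechet_space \<T> \<longleftrightarrow> (\<exists>p :: nat \<Rightarrow> 'q \<Rightarrow> real. (\<forall>k. seminorm (p k)) \<and>
     (\<forall>x. (\<forall>k. p k x = 0) \<longrightarrow> x = 0) \<and>
     (\<forall>U. openin \<T> U \<longleftrightarrow>
        (\<forall>x\<in>U. \<exists>N. \<exists>\<epsilon>>0. \<forall>y. (\<forall>k<N. p k (y - x) < \<epsilon>) \<longrightarrow> y \<in> U)) \<and>
     (\<forall>s. (\<forall>k. \<forall>\<epsilon>>0. \<exists>N. \<forall>m\<ge>N. \<forall>n\<ge>N. p k (s m - s n) < \<epsilon>) \<longrightarrow>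
        (\<exists>l. limitin \<T> s l sequentially)))"

text \<open>The Frechet space is the whole type \<open>'q\<close>, and \<open>\<iota>\<close> picks representatives of the values of its
  continuous injective linear map to \<open>L\<^sup>\<infinity>(X, \<real>)\<close>.\<close>

definition admissible_perturbation_space ::
  "'a measure \<Rightarrow> 'q::real_vector topology \<Rightarrow> ('q \<Rightarrow> 'a \<Rightarrow> real) \<Rightarrow> bool" where
  "admissible_perturbation_space M \<T> \<iota> \<longleftrightarrow> frechet_space \<T> \<and> (\<forall>s. \<iota> s \<in> Linf M) \<and>
     (\<forall>s t. AE x in M. \<iota> (s + t) x = \<iota> s x + \<iota> t x) \<and>
     (\<forall>c s. AE x in M. \<iota> (c *\<^sub>R s) x = c * \<iota> s x) \<and>
     (\<forall>s t. (AE x in M. \<iota> s x = \<iota> t x) \<longrightarrow> s = t) \<and>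
     (\<forall>s. \<forall>\<epsilon>>0. \<exists>U. openin \<T> U \<and> s \<in> U \<and>
        (\<forall>t\<in>U. esssup M (\<lambda>x. ereal \<bar>\<iota> t x - \<iota> s x\<bar>) < ereal \<epsilon>))"

text \<open>The perturbation space as a subset of \<open>L\<^sup>\<infinity>(X, \<real>)\<close>, again closed under
  almost everywhere equality.\<close>

definition perturbations :: "'a measure \<Rightarrow> ('q \<Rightarrow> 'a \<Rightarrow> real) \<Rightarrow> ('a \<Rightarrow> real) set" where
  "perturbations M \<iota> = {f \<in> Linf M. \<exists>s. AE x in M. f x = \<iota> s x}"

end

theory Submission
  imports Defs
begin

text \<open>
  If \<open>P\<^sub>E M\<^sub>\<sigma>\<close> is a scalar \<open>c(\<sigma>)\<close> on \<open>E\<close> for every test function \<open>\<sigma>\<close>, then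
  \<open>\<langle>\<sigma> u, v\<rangle> = c(\<sigma>) \<langle>u, v\<rangle>\<close> for all \<open>u, v \<in> E\<close>. For a given \<open>u\<close> choose \<open>v \<noteq> 0\<close> in \<open>E\<close> orthogonal
  to \<open>u\<close>. Since test functions separate integrable functions on \<open>\<omega>\<close>, it follows that \<open>v \<cdot> cnj u = 0\<close> and
  \<open>\<parallel>v\<parallel>\<^sup>2 |u|\<^sup>2 = \<parallel>u\<parallel>\<^sup>2 |v|\<^sup>2\<close> a.e. on \<open>\<omega>\<close>, which forces \<open>u = 0\<close> there.

  Test functions separate integrable functions because every open
  \<open>W \<subseteq> \<omega>\<close> is a countable union of sets \<open>{\<sigma> \<noteq> 0}\<close> with \<open>\<sigma> \<ge> 0\<close>, and with \<open>flat t = exp (-1/t)\<close> the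
  test functions \<open>flat (n \<sigma>)\<close> converge boundedly to the indicator of \<open>{\<sigma> \<noteq> 0}\<close>.
\<close>

section \<open>Calculus of smooth functions\<close>

lemma times_differentiable_on_subset:
  "times_differentiable_on k V f \<Longrightarrow> W \<subseteq> V \<Longrightarrow> times_differentiable_on k W f"
  by (induction k arbitrary: f) (auto intro: continuous_on_subset)

text \<open>On an open set the values in the set determine the derivatives at its points, so
  agreement of functions passes to their derivatives and the induction continues.\<close>

lemma times_differentiable_on_cong:
  assumes "open V" "times_differentiable_on k V f" "\<And>x. x \<in> V \<Longrightarrow> f x = g x"
  shows "times_differentiable_on k V g"
  using assms(2,3)
proof (induction k arbitrary: f g)
  case 0
  then show ?case by (simp cong: continuous_on_cong)
next
  case (Suc k)
  have der: "(g has_derivative frechet_derivative f (at x)) (at x)" if "x \<in> V" for x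
  proof (rule has_derivative_transform_within_open)
    show "(f has_derivative frechet_derivative f (at x)) (at x)"
      using Suc.prems(1) that by (simp add: frechet_derivative_works[symmetric])
  qed (use assms(1) that Suc.prems(2) in auto)
  have "times_differentiable_on k V (\<lambda>x. frechet_derivative g (at x) v)" for v
  proof (rule Suc.IH)
    show "times_differentiable_on k V (\<lambda>x. frechet_derivative f (at x) v)"
      using Suc.prems(1) by simp
  qed (use frechet_derivative_at[OF der] in simp)
  with der show ?case by (auto simp: differentiable_def)
qed

text \<open>\<open>frechet_derivative\<close> is a choice term; by uniqueness of derivatives any
  explicit formula may replace it. The sum, product and chain rules below rest on this.\<close>

lemma times_differentiable_on_SucI:
  assumes "open V" "\<And>x. x \<in> V \<Longrightarrow> (f has_derivative f' x) (at x)"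
    "\<And>v. times_differentiable_on k V (\<lambda>x. f' x v)"
  shows "times_differentiable_on (Suc k) V f"
proof -
  have "times_differentiable_on k V (\<lambda>x. frechet_derivative f (at x) v)" for v
    by (rule times_differentiable_on_cong[OF assms(1) assms(3)])
      (use frechet_derivative_at[OF assms(2)] in simp)
  with assms(2) show ?thesis by (auto simp: differentiable_def)
qed

lemma times_differentiable_on_Suc_imp:
  "times_differentiable_on (Suc k) V f \<Longrightarrow> times_differentiable_on k V f"
proof (induction k arbitrary: f)
  case 0
  then show ?case
    by (auto intro!: continuous_at_imp_continuous_on differentiable_imp_continuous_within)
next
  case (Suc k)
  show ?case
    unfolding times_differentiable_on.simps(2)[of k]
  proof (intro conjI allI)
    show "\<forall>x\<in>V. f differentiable at x" using Suc.prems by simp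
    show "times_differentiable_on k V (\<lambda>x. frechet_derivative f (at x) v)" for v
      by (rule Suc.IH) (use Suc.prems in \<open>simp only: times_differentiable_on.simps(2)[of "Suc k"]\<close>)
  qed
qed

lemma times_differentiable_on_has_derivative:
  "times_differentiable_on (Suc k) V f \<Longrightarrow> x \<in> V \<Longrightarrow>
    (f has_derivative frechet_derivative f (at x)) (at x)"
  by (simp add: frechet_derivative_works[symmetric])

lemma times_differentiable_on_const [simp]:
  "times_differentiable_on k V (\<lambda>x. c)"
  by (induction k arbitrary: c) auto

lemma times_differentiable_on_add:
  assumes "open V" "times_differentiable_on k V f" "times_differentiable_on k V g"
  shows "times_differentiable_on k V (\<lambda>x. f x + g x)"
  using assms(2,3)
proof (induction k arbitrary: f g)
  case 0
  then show ?case by (simp add: continuous_on_add)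
next
  case (Suc k)
  show ?case
  proof (rule times_differentiable_on_SucI[OF assms(1)])
    show "((\<lambda>x. f x + g x) has_derivative
        (\<lambda>v. frechet_derivative f (at x) v + frechet_derivative g (at x) v)) (at x)" if "x \<in> V" for x
      by (intro has_derivative_add times_differentiable_on_has_derivative[OF Suc.prems(1) that]
        times_differentiable_on_has_derivative[OF Suc.prems(2) that])
    show "times_differentiable_on k V
        (\<lambda>x. frechet_derivative f (at x) v + frechet_derivative g (at x) v)" for v
      using Suc by simp
  qed
qed

text \<open>Stated for an abstract bilinear product so as to serve both multiplication and the inner
  product. Each summand of the product rule keeps one factor undifferentiated; that factor is
  lowered to order \<open>k\<close> before the induction hypothesis applies.\<close>

lemma (in bounded_bilinear) times_differentiable_on:
  assumes "open V" "times_differentiable_on k V f" "times_differentiable_on k V g"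
  shows "times_differentiable_on k V (\<lambda>x. prod (f x) (g x))"
  using assms(2,3)
proof (induction k arbitrary: f g)
  case 0
  then show ?case by (simp add: continuous_on)
next
  case (Suc k)
  show ?case
  proof (rule times_differentiable_on_SucI[OF assms(1)])
    show "((\<lambda>x. prod (f x) (g x)) has_derivative
        (\<lambda>v. prod (f x) (frechet_derivative g (at x) v) + prod (frechet_derivative f (at x) v) (g x))) (at x)"
      if "x \<in> V" for x
      by (intro FDERIV times_differentiable_on_has_derivative[OF Suc.prems(1) that]
        times_differentiable_on_has_derivative[OF Suc.prems(2) that])
    show "times_differentiable_on k V
        (\<lambda>x. prod (f x) (frechet_derivative g (at x) v) + prod (frechet_derivative f (at x) v) (g x))" for v
      by (intro times_differentiable_on_add assms(1) Suc.IH)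
        (use Suc.prems times_differentiable_on_Suc_imp in auto)
  qed
qed

text \<open>\<open>F n\<close> is the \<open>n\<close>-th derivative of \<open>F 0\<close>.\<close>

lemma times_differentiable_on_compose:
  fixes F :: "nat \<Rightarrow> real \<Rightarrow> real"
  assumes "open V" "times_differentiable_on k V s"
    and F: "\<And>n t. (F n has_real_derivative F (Suc n) t) (at t)"
  shows "times_differentiable_on k V (\<lambda>x. F n (s x))"
  using assms(2)
\<comment> \<open>The chain rule turns \<open>F n\<close> into \<open>F (Suc n)\<close>, hence
  \<open>n\<close> must vary.\<close>
proof (induction k arbitrary: n)
  case 0
  have "continuous_on UNIV (F n)"
    using F by (meson DERIV_continuous continuous_at_imp_continuous_on)
  then show ?case
    using 0 continuous_on_compose2[of UNIV "F n" V s] by auto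
next
  case (Suc k)
  show ?case
  proof (rule times_differentiable_on_SucI[OF assms(1)])
    show "((\<lambda>x. F n (s x)) has_derivative
        (\<lambda>v. F (Suc n) (s x) * frechet_derivative s (at x) v)) (at x)" if "x \<in> V" for x
      using has_derivative_compose[OF times_differentiable_on_has_derivative[OF Suc.prems that]
          F[unfolded has_field_derivative_def]] by simp
    show "times_differentiable_on k V (\<lambda>x. F (Suc n) (s x) * frechet_derivative s (at x) v)" for v
      by (intro bounded_bilinear.times_differentiable_on[OF bounded_bilinear_mult] assms(1) Suc.IH
          times_differentiable_on_Suc_imp[OF Suc.prems]) (use Suc.prems in simp)
  qed
qed

subsection \<open>The flat function\<close>

text \<open>The \<open>n\<close>-th derivative of \<open>exp (-1/t)\<close> is \<open>P\<^sub>n(1/t) exp (-1/t)\<close> with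
  \<open>P\<^sub>n\<^sub>+\<^sub>1(s) = s\<^sup>2 (P\<^sub>n(s) - P\<^sub>n'(s))\<close>.\<close>

definition flat_poly :: "nat \<Rightarrow> real poly" where
  "flat_poly n = ((\<lambda>p. [:0, 0, 1:] * (p - pderiv p)) ^^ n) 1"

definition flat_deriv :: "nat \<Rightarrow> real \<Rightarrow> real" where
  "flat_deriv n t = (if t \<le> 0 then 0 else poly (flat_poly n) (inverse t) * exp (- inverse t))"

text \<open>The exponential dominates every monomial. With \<open>s = 1/h\<close> this limit
  controls the flat function to the right of the origin.\<close>

lemma poly_times_exp_neg_tendsto_0:
  "((\<lambda>s. poly p s * exp (- s)) \<longlongrightarrow> (0::real)) at_top"
proof -
  have "((\<lambda>s::real. \<Sum>i\<le>degree p. coeff p i * (s ^ i / exp s)) \<longlongrightarrow> (\<Sum>i\<le>degree p. coeff p i * 0)) at_top"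
    by (intro tendsto_intros tendsto_power_div_exp_0)
  then show ?thesis
    by (simp add: poly_altdef sum_divide_distrib exp_minus field_simps)
qed

text \<open>The delicate point is the origin: difference quotients from the left vanish, and those
  from the right are a polynomial in \<open>s = 1/h\<close> times \<open>exp (-s)\<close>, which
  tends to \<open>0\<close>.\<close>

lemma flat_deriv_has_real_derivative:
  "(flat_deriv n has_real_derivative flat_deriv (Suc n) t) (at t)"
proof -
  consider "t < 0" | "t > 0" | "t = 0" by linarith
  then show ?thesis
  proof cases
    case 1
    have "((\<lambda>_. 0) has_real_derivative 0) (at t)" by simp
    then have "(flat_deriv n has_real_derivative 0) (at t)"
      by (rule has_field_derivative_transform_within_open[where S = "{..<0}"])
        (use 1 in \<open>auto simp: flat_deriv_def\<close>)
    with 1 show ?thesis by (simp add: flat_deriv_def)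
  next
    case 2
    let ?p = "flat_poly n"
    have "((\<lambda>t. poly ?p (inverse t) * exp (- inverse t)) has_real_derivative
        flat_deriv (Suc n) t) (at t)"
      using 2
      by (auto intro!: derivative_eq_intros poly_DERIV[THEN DERIV_chain2]
          simp: flat_deriv_def flat_poly_def algebra_simps power2_eq_square)
    then show ?thesis
      by (rule has_field_derivative_transform_within_open[where S = "{0<..}"])
        (use 2 in \<open>auto simp: flat_deriv_def\<close>)
  next
    case 3
    \<comment> \<open>Division by \<open>h\<close> is multiplication by \<open>s = 1/h\<close>,
      which is the extra polynomial factor \<open>[:0, 1:]\<close>.\<close>
    have r: "((\<lambda>h. poly ([:0, 1:] * flat_poly n) (inverse h) * exp (- inverse h)) \<longlongrightarrow> 0) (at_right 0)"
      by (rule filterlim_compose[OF poly_times_exp_neg_tendsto_0 filterlim_inverse_at_top_right])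
    have "((\<lambda>h. flat_deriv n h / h) \<longlongrightarrow> 0) (at_right 0)"
      by (rule Lim_transform_eventually[OF r])
        (auto simp: flat_deriv_def eventually_at_filter field_simps)
    moreover have "((\<lambda>h. flat_deriv n h / h) \<longlongrightarrow> 0) (at_left 0)"
      by (rule Lim_transform_eventually[OF tendsto_const])
        (auto simp: flat_deriv_def eventually_at_filter)
    ultimately have "((\<lambda>h. flat_deriv n h / h) \<longlongrightarrow> 0) (at 0)"
      by (simp add: filterlim_split_at)
    with 3 show ?thesis
      by (simp add: DERIV_def flat_deriv_def)
  qed
qed

abbreviation flat :: "real \<Rightarrow> real" where
  "flat \<equiv> flat_deriv 0"

lemma flat_altdef: "flat t = (if t \<le> 0 then 0 else exp (- inverse t))"
  by (simp add: flat_deriv_def flat_poly_def)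

lemma flat_simps [simp]:
  "0 \<le> flat t" "flat t \<le> 1" "flat t = 0 \<longleftrightarrow> t \<le> 0"
  by (auto simp: flat_altdef)

lemma flat_scaled_tendsto:
  assumes "0 \<le> t"
  shows "(\<lambda>n. flat (real n * t)) \<longlonglongrightarrow> (if t = 0 then 0 else 1)"
proof (cases "t = 0")
  case False
  with assms have "0 < t" by simp
  then have "filterlim (\<lambda>n. real n * t) at_top sequentially"
    by (intro filterlim_at_top_mult_tendsto_pos[OF tendsto_const]) (auto intro: filterlim_real_sequentially)
  then have "(\<lambda>n. exp (- inverse (real n * t))) \<longlonglongrightarrow> exp (- 0)"
    by (intro tendsto_intros tendsto_inverse_0_at_top)
  \<comment> \<open>The two sequences agree only from \<open>n = 1\<close> on: at
    \<open>n = 0\<close> the flat function is \<open>0\<close>, whereas the exponential is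
    \<open>1\<close> because \<open>inverse 0 = 0\<close>.\<close>
  then have "(\<lambda>n. flat (real n * t)) \<longlonglongrightarrow> exp (- 0)"
    by (rule Lim_transform_eventually)
      (use \<open>0 < t\<close> in \<open>auto simp: flat_altdef mult_le_0_iff intro!: eventually_sequentiallyI[of 1]\<close>)
  with False show ?thesis by simp
qed (simp add: flat_altdef)

section \<open>Test functions on a manifold\<close>

lemma smooth_onE:
  assumes "smooth_on S f" "x \<in> S"
  obtains V g where "open V" "x \<in> V" "\<And>k. times_differentiable_on k V g"
    "\<And>y. y \<in> V \<Longrightarrow> y \<in> S \<Longrightarrow> g y = f y"
  using assms unfolding smooth_on_def by (meson IntI)

lemma smooth_onI:
  assumes "\<And>x. x \<in> S \<Longrightarrow> \<exists>V g. open V \<and> x \<in> V \<and> (\<forall>k. times_differentiable_on k V g) \<and>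
    (\<forall>y. y \<in> V \<longrightarrow> y \<in> S \<longrightarrow> g y = f y)"
  shows "smooth_on S f"
  using assms unfolding smooth_on_def by (meson IntE)

lemma smooth_on_add:
  assumes "smooth_on S f" "smooth_on S g"
  shows "smooth_on S (\<lambda>x. f x + g x)"
proof (rule smooth_onI)
  fix x assume x: "x \<in> S"
  obtain V f' where
    V: "open V" "x \<in> V" "\<And>k. times_differentiable_on k V f'"
      "\<And>y. y \<in> V \<Longrightarrow> y \<in> S \<Longrightarrow> f' y = f y"
    using smooth_onE[OF assms(1) x] by blast
  obtain W g' where
    W: "open W" "x \<in> W" "\<And>k. times_differentiable_on k W g'"
      "\<And>y. y \<in> W \<Longrightarrow> y \<in> S \<Longrightarrow> g' y = g y"
    using smooth_onE[OF assms(2) x] by blast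
  have "times_differentiable_on k (V \<inter> W) f'" "times_differentiable_on k (V \<inter> W) g'" for k
    using V(3) W(3) by (auto intro: times_differentiable_on_subset)
  with V W show "\<exists>V h. open V \<and> x \<in> V \<and> (\<forall>k. times_differentiable_on k V h) \<and>
      (\<forall>y. y \<in> V \<longrightarrow> y \<in> S \<longrightarrow> h y = f y + g y)"
    by (intro exI[of _ "V \<inter> W"] exI[of _ "\<lambda>y. f' y + g' y"])
      (auto intro!: times_differentiable_on_add)
qed

lemma smooth_on_flat_scaled:
  assumes "smooth_on S f"
  shows "smooth_on S (\<lambda>x. flat (c * f x))"
proof (rule smooth_onI)
  fix x assume x: "x \<in> S"
  obtain V f' where
    f': "open V" "x \<in> V" "\<And>k. times_differentiable_on k V f'"
      "\<And>y. y \<in> V \<Longrightarrow> y \<in> S \<Longrightarrow> f' y = f y"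
    using smooth_onE[OF assms x] by blast
  have "times_differentiable_on k V (\<lambda>y. flat (c * f' y))" for k
    by (rule times_differentiable_on_compose[where F = flat_deriv, OF f'(1) _ flat_deriv_has_real_derivative])
      (intro bounded_bilinear.times_differentiable_on[OF bounded_bilinear_mult] f'
        times_differentiable_on_const)
  with f' show "\<exists>V h. open V \<and> x \<in> V \<and> (\<forall>k. times_differentiable_on k V h) \<and>
      (\<forall>y. y \<in> V \<longrightarrow> y \<in> S \<longrightarrow> h y = flat (c * f y))"
    by (intro exI[of _ V] exI[of _ "\<lambda>y. flat (c * f' y)"]) auto
qed

lemma smooth_on_imp_continuous_on:
  assumes "smooth_on S f"
  shows "continuous_on S f"
  unfolding continuous_on_eq_continuous_within
proof
  fix x assume x: "x \<in> S"
  obtain V g where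
    g: "open V" "x \<in> V" "\<And>k. times_differentiable_on k V g"
      "\<And>y. y \<in> V \<Longrightarrow> y \<in> S \<Longrightarrow> g y = f y"
    using smooth_onE[OF assms x] by blast
  have "continuous_on V g" using g(3)[of 0] by simp
  then have "isCont g x" using g by (simp add: continuous_on_eq_continuous_at)
  then have "continuous (at x within S) g" by (rule continuous_at_imp_continuous_at_within)
  moreover have "\<forall>\<^sub>F y in at x within S. g y = f y"
    using g by (auto simp: eventually_at_topological)
  then have "(g \<longlongrightarrow> f x) (at x within S) \<longleftrightarrow> (f \<longlongrightarrow> f x) (at x within S)"
    by (rule tendsto_cong)
  ultimately show "continuous (at x within S) f"
    using g(4)[OF g(2) x] by (simp add: continuous_within)
qed

section \<open>Test functions: algebra, continuity, boundedness\<close>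

lemma Cc_smooth_zero_outside:
  "\<sigma> \<in> Cc_smooth \<A> \<omega> \<Longrightarrow> x \<notin> \<omega> \<Longrightarrow> \<sigma> x = 0"
  using closure_subset[of "{x. \<sigma> x \<noteq> 0}"] by (auto simp: Cc_smooth_def)

lemma Cc_smooth_zero: "(\<lambda>x. 0) \<in> Cc_smooth \<A> \<omega>"
  by (auto simp: Cc_smooth_def smooth_on_def o_def intro!: exI[of _ UNIV] exI[of _ "\<lambda>_. 0"])

lemma closed_subset_compact:
  fixes S :: "'a::t2_space set"
  assumes "compact S" "T \<subseteq> S" "closed T"
  shows "compact T"
  using compact_Int_closed[OF assms(1,3)] assms(2) by (simp add: Int_absorb1)

lemma Cc_smooth_add:
  fixes \<A> :: "('a::t2_space, 'b::euclidean_space) chart set"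
  assumes "\<sigma> \<in> Cc_smooth \<A> \<omega>" "\<tau> \<in> Cc_smooth \<A> \<omega>"
  shows "(\<lambda>x. \<sigma> x + \<tau> x) \<in> Cc_smooth \<A> \<omega>"
proof -
  have "closure {x. \<sigma> x + \<tau> x \<noteq> 0} \<subseteq> closure ({x. \<sigma> x \<noteq> 0} \<union> {x. \<tau> x \<noteq> 0})"
    by (rule closure_mono) auto
  then have s: "closure {x. \<sigma> x + \<tau> x \<noteq> 0} \<subseteq> closure {x. \<sigma> x \<noteq> 0} \<union> closure {x. \<tau> x \<noteq> 0}"
    by simp
  moreover have "compact (closure {x. \<sigma> x \<noteq> 0} \<union> closure {x. \<tau> x \<noteq> 0})"
    using assms by (auto simp: Cc_smooth_def)
  ultimately have "compact (closure {x. \<sigma> x + \<tau> x \<noteq> 0})"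
    by (auto intro: closed_subset_compact)
  with s assms show ?thesis
    by (auto simp: Cc_smooth_def o_def intro!: smooth_on_add)
qed

lemma Cc_smooth_flat_scaled:
  fixes \<A> :: "('a::t2_space, 'b::euclidean_space) chart set"
  assumes "\<sigma> \<in> Cc_smooth \<A> \<omega>"
  shows "(\<lambda>x. flat (c * \<sigma> x)) \<in> Cc_smooth \<A> \<omega>"
proof -
  have s: "closure {x. flat (c * \<sigma> x) \<noteq> 0} \<subseteq> closure {x. \<sigma> x \<noteq> 0}"
    by (rule closure_mono) auto
  moreover have "compact (closure {x. \<sigma> x \<noteq> 0})"
    using assms by (auto simp: Cc_smooth_def)
  ultimately have "compact (closure {x. flat (c * \<sigma> x) \<noteq> 0})"
    by (auto intro: closed_subset_compact)
  with s assms show ?thesis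
    by (auto simp: Cc_smooth_def o_def intro!: smooth_on_flat_scaled)
qed

lemma smooth_manifold_chart:
  assumes "smooth_manifold B \<A>" "(U, \<phi>) \<in> \<A>"
  shows "open U" "homeomorphism U (\<phi> ` U) \<phi> (inv_into U \<phi>)" "\<phi> ` U \<subseteq> span B"
proof -
  have c: "is_chart B (U, \<phi>)" using assms by (auto simp: smooth_manifold_def)
  then show "open U" "homeomorphism U (\<phi> ` U) \<phi> (inv_into U \<phi>)"
    by (auto simp: is_chart_def)
  from c have "openin (top_of_set (span B)) (\<phi> ` U) \<or>
      (\<exists>e\<in>B. openin (top_of_set (half_space B e)) (\<phi> ` U))"
    by (simp add: is_chart_def)
  then have "\<phi> ` U \<subseteq> span B \<or> (\<exists>e. \<phi> ` U \<subseteq> half_space B e)"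
    using openin_imp_subset by blast
  moreover have "half_space B e \<subseteq> span B" for e
    by (auto simp: half_space_def)
  ultimately show "\<phi> ` U \<subseteq> span B" by blast
qed

text \<open>Continuity is checked on the open chart domains, which cover the manifold: there the
  function is its coordinate expression composed with the chart.\<close>

lemma Cc_smooth_continuous:
  assumes M: "smooth_manifold B \<A>" and \<sigma>: "\<sigma> \<in> Cc_smooth \<A> \<omega>"
  shows "continuous_on UNIV \<sigma>"
proof -
  have "continuous_on (\<Union>c\<in>\<A>. fst c) \<sigma>"
  proof (rule continuous_on_open_UN)
    fix c assume "c \<in> \<A>"
    then obtain U \<phi> where c: "c = (U, \<phi>)" "(U, \<phi>) \<in> \<A>" by (cases c) auto
    note ch = smooth_manifold_chart[OF M c(2)]
    show "open (fst c)" using c ch by simp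
    have "smooth_on (\<phi> ` U) (\<sigma> \<circ> inv_into U \<phi>)"
      using \<sigma> c(2) unfolding Cc_smooth_def by blast
    then have "continuous_on U (\<lambda>x. (\<sigma> \<circ> inv_into U \<phi>) (\<phi> x))"
      by (rule continuous_on_compose2[OF smooth_on_imp_continuous_on homeomorphism_cont1[OF ch(2)]])
        simp
    then have "continuous_on U \<sigma>"
      by (rule continuous_on_eq) (simp add: homeomorphism_apply1[OF ch(2)])
    with c(1) show "continuous_on (fst c) \<sigma>" by simp
  qed
  moreover have "(\<Union>c\<in>\<A>. fst c) = UNIV"
    using M by (auto simp: smooth_manifold_def case_prod_unfold)
  ultimately show ?thesis by simp
qed

lemma Cc_smooth_bounded:
  assumes "smooth_manifold B \<A>" and \<sigma>: "\<sigma> \<in> Cc_smooth \<A> \<omega>"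
  obtains C where "0 \<le> C" "\<And>x. \<bar>\<sigma> x\<bar> \<le> C"
proof -
  let ?K = "closure {x. \<sigma> x \<noteq> 0}"
  have "compact (\<sigma> ` ?K)"
    using \<sigma> by (intro compact_continuous_image continuous_on_subset[OF Cc_smooth_continuous[OF assms]])
      (auto simp: Cc_smooth_def)
  then obtain C where "\<And>x. x \<in> ?K \<Longrightarrow> \<bar>\<sigma> x\<bar> \<le> C"
    using compact_imp_bounded[of "\<sigma> ` ?K"] by (auto simp: bounded_iff)
  \<comment> \<open>The bound \<open>max 0 C\<close> also covers points outside the support, where
    the value is \<open>0\<close>; \<open>C\<close> itself might be negative if the support is
    empty.\<close>
  then have "\<bar>\<sigma> x\<bar> \<le> max 0 C" for x
    using closure_subset[of "{x. \<sigma> x \<noteq> 0}"] by (cases "\<sigma> x = 0") (auto simp: le_max_iff_disj)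
  then show ?thesis by (intro that[of "max 0 C"]) auto
qed

text \<open>The bump is the flat function of \<open>r^2 - |z - p|^2\<close> in a chart around
  \<open>x\<close>, with \<open>p\<close> the image of \<open>x\<close>, extended by zero. It is
  smooth because two open sets cover the manifold: the chart domain, and the complement of a compact
  set \<open>K\<close> containing the support.\<close>

lemma ex_Cc_smooth_bump:
  fixes \<A> :: "('a::{t2_space, second_countable_topology}, 'b::euclidean_space) chart set"
  assumes M: "smooth_manifold B \<A>" and "open W" "x \<in> W" "W \<subseteq> \<omega>" "\<omega> \<subseteq> manifold_interior B \<A>"
  shows "\<exists>\<sigma>\<in>Cc_smooth \<A> \<omega>. (\<forall>y. 0 \<le> \<sigma> y) \<and> \<sigma> x \<noteq> 0 \<and> {y. \<sigma> y \<noteq> 0} \<subseteq> W"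
proof -
  have "x \<in> manifold_interior B \<A>" using assms by auto
  then obtain U \<phi> where U: "(U, \<phi>) \<in> \<A>" "x \<in> U"
    and int: "\<phi> x \<in> top_of_set (span B) interior_of (\<phi> ` U)"
    by (auto simp: manifold_interior_def)
  note ch = smooth_manifold_chart[OF M U(1)]
  note inv = homeomorphism_apply1[OF ch(2)]
  have "openin (top_of_set (\<phi> ` U)) (\<phi> ` (U \<inter> W))"
    using homeomorphism_imp_open_map[OF ch(2)] \<open>open W\<close> by blast
  then obtain T where T: "open T" "\<phi> ` (U \<inter> W) = \<phi> ` U \<inter> T"
    by (auto simp: openin_open)
  let ?I = "top_of_set (span B) interior_of (\<phi> ` U)"
  have "openin (top_of_set (span B)) (?I \<inter> T)"
    using T by (intro openin_Int_open) auto
  moreover have "\<phi> x \<in> ?I \<inter> T" using int T U \<open>x \<in> W\<close> by auto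
  ultimately obtain r where r: "0 < r" "cball (\<phi> x) r \<inter> span B \<subseteq> ?I \<inter> T"
    unfolding openin_contains_cball by blast
  define C where "C = cball (\<phi> x) r \<inter> span B"
  have C: "C \<subseteq> \<phi> ` (U \<inter> W)"
    using r T interior_of_subset[of "top_of_set (span B)" "\<phi> ` U"] by (auto simp: C_def)
  define K where "K = inv_into U \<phi> ` C"
  have "compact C" by (simp add: C_def compact_Int_closed closed_subspace)
  moreover have "continuous_on C (inv_into U \<phi>)"
    by (rule continuous_on_subset[OF homeomorphism_cont2[OF ch(2)]]) (use C in auto)
  ultimately have K: "compact K"
    unfolding K_def by (rule compact_continuous_image[rotated])
  have KW: "K \<subseteq> U \<inter> W" using C inv by (fastforce simp: K_def)
  define \<rho> where "\<rho> z = flat (r\<^sup>2 - (z - \<phi> x) \<bullet> (z - \<phi> x))" for z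
  define \<sigma> where "\<sigma> y = (if y \<in> U then \<rho> (\<phi> y) else 0)" for y
  have supp: "{y. \<sigma> y \<noteq> 0} \<subseteq> K"
  proof
    fix y assume "y \<in> {y. \<sigma> y \<noteq> 0}"
    then have y: "y \<in> U" "(\<phi> y - \<phi> x) \<bullet> (\<phi> y - \<phi> x) < r\<^sup>2"
      by (auto simp: \<sigma>_def \<rho>_def split: if_splits)
    then have "norm (\<phi> y - \<phi> x) < r"
      using r by (simp add: norm_lt_square)
    then have "dist (\<phi> x) (\<phi> y) < r"
      by (simp add: dist_norm norm_minus_commute)
    then have "\<phi> y \<in> C" using y ch(3) by (auto simp: C_def)
    then show "y \<in> K" using inv[OF y(1)] by (force simp: K_def)
  qed
  then have clos: "closure {y. \<sigma> y \<noteq> 0} \<subseteq> K"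
    by (intro closure_minimal compact_imp_closed K)
  have "smooth_on (\<phi>' ` U') (\<sigma> \<circ> inv_into U' \<phi>')" if U': "(U', \<phi>') \<in> \<A>" for U' \<phi>'
  proof (rule smooth_onI)
    fix z assume z: "z \<in> \<phi>' ` U'"
    note ch' = smooth_manifold_chart[OF M U']
    note inv' = homeomorphism_apply1[OF ch'(2)]
    let ?goal = "\<exists>V g. open V \<and> z \<in> V \<and> (\<forall>k. times_differentiable_on k V g) \<and>
      (\<forall>y. y \<in> V \<longrightarrow> y \<in> \<phi>' ` U' \<longrightarrow> g y = (\<sigma> \<circ> inv_into U' \<phi>') y)"
    from z obtain y where y: "y \<in> U'" "z = \<phi>' y" by auto
    have open_image: "\<exists>T. open T \<and> \<phi>' ` (U' \<inter> Y) = \<phi>' ` U' \<inter> T" if "open Y" for Y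
      using homeomorphism_imp_open_map[OF ch'(2), of "U' \<inter> Y"] that by (auto simp: openin_open)
    \<comment> \<open>\<open>K\<close> lies in \<open>U\<close>, so the open sets \<open>U\<close>
      and \<open>- K\<close> cover the manifold.\<close>
    consider "y \<in> U" | "y \<notin> K" using KW by auto
    then show ?goal
    proof cases
      case 1
      have "smooth_on (\<phi>' ` (U' \<inter> U)) (\<phi> \<circ> inv_into U' \<phi>')"
        using M U U' by (auto simp: smooth_manifold_def)
      moreover have "z \<in> \<phi>' ` (U' \<inter> U)" using 1 y by auto
      ultimately obtain V g where g: "open V" "z \<in> V" "\<And>k. times_differentiable_on k V g"
        "\<And>y. y \<in> V \<Longrightarrow> y \<in> \<phi>' ` (U' \<inter> U) \<Longrightarrow> g y = (\<phi> \<circ> inv_into U' \<phi>') y"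
        by (rule smooth_onE) blast
      \<comment> \<open>\<open>g\<close> is known to match the transition map only over the overlap
        of the charts; intersecting with \<open>T\<close> removes the points of \<open>V\<close>
        that come from outside \<open>U\<close>.\<close>
      from open_image[OF ch(1)] obtain T where T: "open T" "\<phi>' ` (U' \<inter> U) = \<phi>' ` U' \<inter> T" by auto
      have VT: "open (V \<inter> T)" "\<And>k. times_differentiable_on k (V \<inter> T) g"
        using g T by (auto intro: times_differentiable_on_subset)
      have "times_differentiable_on k (V \<inter> T) (\<lambda>w. (g w + - \<phi> x) \<bullet> (g w + - \<phi> x))" for k
        by (intro bounded_bilinear.times_differentiable_on[OF bounded_bilinear_inner] VT
            times_differentiable_on_add times_differentiable_on_const)
      then have "times_differentiable_on k (V \<inter> T)
          (\<lambda>w. r\<^sup>2 + (-1) * ((g w + - \<phi> x) \<bullet> (g w + - \<phi> x)))" for k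
        by (intro times_differentiable_on_add times_differentiable_on_const VT
            bounded_bilinear.times_differentiable_on[OF bounded_bilinear_mult])
      then have "times_differentiable_on k (V \<inter> T) (\<lambda>w. \<rho> (g w))" for k
        using times_differentiable_on_compose[where F = flat_deriv and n = 0,
            OF VT(1) _ flat_deriv_has_real_derivative]
        by (simp add: \<rho>_def)
      moreover have "\<rho> (g w) = (\<sigma> \<circ> inv_into U' \<phi>') w" if "w \<in> V \<inter> T \<inter> \<phi>' ` U'" for w
      proof -
        have "w \<in> \<phi>' ` (U' \<inter> U)" using that T by auto
        then obtain y' where "y' \<in> U' \<inter> U" "w = \<phi>' y'" by auto
        then show ?thesis using g(4)[of w] that inv' by (auto simp: \<sigma>_def)
      qed
      moreover have "z \<in> V \<inter> T" using g T y 1 by auto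
      ultimately show ?goal using VT(1) by blast
    next
      case 2
      have "open (- K)" using K by (simp add: compact_imp_closed open_Compl)
      from open_image[OF this] obtain T where T: "open T" "\<phi>' ` (U' \<inter> - K) = \<phi>' ` U' \<inter> T" by auto
      have "0 = (\<sigma> \<circ> inv_into U' \<phi>') w" if "w \<in> T \<inter> \<phi>' ` U'" for w
      proof -
        have "w \<in> \<phi>' ` (U' \<inter> - K)" using that T by auto
        then obtain y' where "y' \<in> U' \<inter> - K" "w = \<phi>' y'" by auto
        then show ?thesis using supp inv' by auto
      qed
      moreover have "z \<in> T" using T y 2 by auto
      ultimately show ?goal using T(1)
        by (intro exI[of _ T] exI[of _ "\<lambda>_. 0"]) auto
    qed
  qed
  then have "\<sigma> \<in> Cc_smooth \<A> \<omega>"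
    using clos KW \<open>W \<subseteq> \<omega>\<close> closed_subset_compact[OF K clos] by (auto simp: Cc_smooth_def)
  moreover have "\<forall>y. 0 \<le> \<sigma> y"
    by (simp add: \<sigma>_def \<rho>_def)
  moreover have "\<sigma> x \<noteq> 0"
    using r(1) U(2) by (simp add: \<sigma>_def \<rho>_def)
  moreover have "{y. \<sigma> y \<noteq> 0} \<subseteq> W"
    using supp KW by blast
  ultimately show ?thesis by blast
qed

section \<open>The fundamental lemma of the calculus of variations\<close>

lemma Cc_smooth_mult_integrable:
  fixes f :: "'a::{t2_space, second_countable_topology} \<Rightarrow> real"
  assumes M: "smooth_manifold B \<A>" and S: "sets \<mu> = sets borel"
    and \<sigma>: "\<sigma> \<in> Cc_smooth \<A> \<omega>" and f: "integrable \<mu> f"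
  shows "integrable \<mu> (\<lambda>x. \<sigma> x * f x)"
proof -
  obtain C where C: "0 \<le> C" "\<And>x. \<bar>\<sigma> x\<bar> \<le> C"
    using Cc_smooth_bounded[OF M \<sigma>] by blast
  have [measurable]: "\<sigma> \<in> borel_measurable \<mu>" "f \<in> borel_measurable \<mu>"
    using borel_measurable_continuous_onI[OF Cc_smooth_continuous[OF M \<sigma>]] f S
    by (simp_all cong: measurable_cong_sets)
  show ?thesis
  proof (rule Bochner_Integration.integrable_bound)
    show "integrable \<mu> (\<lambda>x. C * f x)" using f by simp
    show "AE x in \<mu>. norm (\<sigma> x * f x) \<le> norm (C * f x)"
      using C by (auto simp: abs_mult intro!: mult_right_mono)
  qed measurable
qed

context
  fixes B :: "'b::euclidean_space set"
    and \<A> :: "('a::{t2_space, second_countable_topology}, 'b) chart set"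
    and \<mu> :: "'a measure" and \<omega> :: "'a set" and f :: "'a \<Rightarrow> real"
  assumes M: "smooth_manifold B \<A>" and S: "sets \<mu> = sets borel"
    and \<omega>: "open \<omega>" "\<omega> \<subseteq> manifold_interior B \<A>"
    and f: "integrable \<mu> f"
    and orth: "\<And>\<sigma>. \<sigma> \<in> Cc_smooth \<A> \<omega> \<Longrightarrow> (\<integral>x. \<sigma> x * f x \<partial>\<mu>) = 0"
begin

text \<open>The functions \<open>flat (n * \<sigma> x)\<close> are test functions with values in
  [0, 1]. Each has integral \<open>0\<close> against \<open>f\<close>, and dominated convergence
  with majorant \<open>|f|\<close> carries this to the limit.\<close>

lemma integral_indicator_support_eq_0:
  assumes \<sigma>: "\<sigma> \<in> Cc_smooth \<A> \<omega>" "\<And>x. 0 \<le> \<sigma> x"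
  shows "(\<integral>x. indicator {x. \<sigma> x \<noteq> 0} x * f x \<partial>\<mu>) = 0"
proof -
  have [measurable]: "f \<in> borel_measurable \<mu>" "\<sigma> \<in> borel_measurable \<mu>"
    using borel_measurable_continuous_onI[OF Cc_smooth_continuous[OF M \<sigma>(1)]] f S
    by (simp_all cong: measurable_cong_sets)
  have [simp]: "space \<mu> = UNIV" using sets_eq_imp_space_eq[OF S] by simp
  have "{x \<in> space \<mu>. \<sigma> x \<noteq> 0} \<in> sets \<mu>" by measurable
  then have [measurable]: "{x. \<sigma> x \<noteq> 0} \<in> sets \<mu>" by simp
  have F: "(\<lambda>x. flat (real n * \<sigma> x)) \<in> Cc_smooth \<A> \<omega>" for n
    by (rule Cc_smooth_flat_scaled[OF \<sigma>(1)])
  have "(\<lambda>n. \<integral>x. flat (real n * \<sigma> x) * f x \<partial>\<mu>) \<longlonglongrightarrow>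
      (\<integral>x. indicator {x. \<sigma> x \<noteq> 0} x * f x \<partial>\<mu>)"
  proof (rule integral_dominated_convergence[where w = "\<lambda>x. norm (f x)"])
    show "integrable \<mu> (\<lambda>x. norm (f x))" using f by simp
    show "(\<lambda>x. indicator {x. \<sigma> x \<noteq> 0} x * f x) \<in> borel_measurable \<mu>" by measurable
    show "(\<lambda>x. flat (real n * \<sigma> x) * f x) \<in> borel_measurable \<mu>" for n
      using Cc_smooth_mult_integrable[OF M S F f] by (rule borel_measurable_integrable)
    show "AE x in \<mu>. norm (flat (real n * \<sigma> x) * f x) \<le> norm (f x)" for n
      by (intro AE_I2) (auto simp: abs_mult intro!: mult_left_le_one_le)
    have "(\<lambda>n. flat (real n * \<sigma> x) * f x) \<longlonglongrightarrow> indicator {x. \<sigma> x \<noteq> 0} x * f x" for x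
      using tendsto_mult[OF flat_scaled_tendsto[OF \<sigma>(2)] tendsto_const, of x "f x"]
      by (cases "\<sigma> x = 0") simp_all
    then show "AE x in \<mu>. (\<lambda>n. flat (real n * \<sigma> x) * f x) \<longlonglongrightarrow> indicator {x. \<sigma> x \<noteq> 0} x * f x"
      by simp
  qed
  then show ?thesis
    using orth[OF F] by (simp add: LIMSEQ_const_iff)
qed

text \<open>By the Lindelof property countably many sets where a bump is nonzero exhaust
  \<open>W\<close>. Partial sums of these bumps are test functions, and the sets where they are
  nonzero increase to \<open>W\<close>.\<close>

lemma integral_indicator_open_eq_0:
  assumes W: "open W" "W \<subseteq> \<omega>"
  shows "(\<integral>x. indicator W x * f x \<partial>\<mu>) = 0"
proof -
  let ?bump = "\<lambda>\<sigma>. \<sigma> \<in> Cc_smooth \<A> \<omega> \<and> (\<forall>x. 0 \<le> \<sigma> x) \<and> {x. \<sigma> x \<noteq> 0} \<subseteq> W"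
  have [measurable]: "f \<in> borel_measurable \<mu>" using f by simp
  have op: "open {x. \<sigma> x \<noteq> 0}" if "?bump \<sigma>" for \<sigma>
    using Cc_smooth_continuous[OF M, of \<sigma> \<omega>] that by (intro open_Collect_neq) auto
  have "open S" if "S \<in> (\<lambda>\<sigma>. {x. \<sigma> x \<noteq> 0}) ` Collect ?bump" for S
    using that op by (elim imageE) simp
  then obtain \<F> where \<F>: "\<F> \<subseteq> (\<lambda>\<sigma>. {x. \<sigma> x \<noteq> 0}) ` Collect ?bump" "countable \<F>"
    "\<Union>\<F> = \<Union>((\<lambda>\<sigma>. {x. \<sigma> x \<noteq> 0}) ` Collect ?bump)"
    by (rule Lindelof)
  have FW: "\<Union>\<F> = W"
    unfolding \<F>(3)
  proof (intro equalityI subsetI)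
    fix x assume "x \<in> W"
    then obtain \<sigma> where "\<sigma> \<in> Cc_smooth \<A> \<omega>" "\<forall>y. 0 \<le> \<sigma> y" "\<sigma> x \<noteq> 0" "{y. \<sigma> y \<noteq> 0} \<subseteq> W"
      using ex_Cc_smooth_bump[OF M W(1) _ W(2) \<omega>(2)] by metis
    then show "x \<in> (\<Union>\<sigma>\<in>Collect ?bump. {x. \<sigma> x \<noteq> 0})"
      by (intro UN_I[of \<sigma>]) simp_all
  next
    fix x assume "x \<in> (\<Union>\<sigma>\<in>Collect ?bump. {x. \<sigma> x \<noteq> 0})"
    then obtain \<sigma> where "?bump \<sigma>" "\<sigma> x \<noteq> 0" by (elim UN_E) simp
    then show "x \<in> W" by (meson subsetD mem_Collect_eq)
  qed
  show ?thesis
  proof (cases "\<F> = {}")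
    case True
    with FW have "W = {}" by simp
    then show ?thesis by simp
  next
    case False
    \<comment> \<open>The enumeration of the nonempty countable family may repeat members, which
      does no harm to a union.\<close>
    define \<sigma> where "\<sigma> i = (SOME \<sigma>. ?bump \<sigma> \<and> {x. \<sigma> x \<noteq> 0} = from_nat_into \<F> i)" for i
    have \<sigma>: "?bump (\<sigma> i)" "{x. \<sigma> i x \<noteq> 0} = from_nat_into \<F> i" for i
    proof -
      have "\<exists>\<sigma>. ?bump \<sigma> \<and> {x. \<sigma> x \<noteq> 0} = from_nat_into \<F> i"
        using subsetD[OF \<F>(1) from_nat_into[OF False, of i]] by (elim imageE) blast
      from someI_ex[OF this] show "?bump (\<sigma> i)" "{x. \<sigma> i x \<noteq> 0} = from_nat_into \<F> i"
        unfolding \<sigma>_def by blast+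
    qed
    define s where "s N x = (\<Sum>i<N. \<sigma> i x)" for N x
    have s: "s N \<in> Cc_smooth \<A> \<omega>" for N
    proof (induction N)
      case 0
      then show ?case using Cc_smooth_zero by (simp add: s_def[abs_def])
    next
      case (Suc N)
      have "s (Suc N) = (\<lambda>x. s N x + \<sigma> N x)" by (simp add: s_def[abs_def])
      with Suc \<sigma>(1)[of N] show ?case by (simp add: Cc_smooth_add)
    qed
    have s0: "0 \<le> s N x" for N x
      using \<sigma>(1) by (auto simp: s_def intro!: sum_nonneg)
    have supp: "{x. s N x \<noteq> 0} = (\<Union>i<N. from_nat_into \<F> i)" for N
    proof -
      \<comment> \<open>Nonnegativity excludes cancellation, so a partial sum vanishes only where
        all its terms vanish.\<close>
      have "s N x = 0 \<longleftrightarrow> (\<forall>i<N. \<sigma> i x = 0)" for x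
        unfolding s_def using \<sigma>(1) by (subst sum_nonneg_eq_0_iff) auto
      then show ?thesis by (auto simp flip: \<sigma>(2))
    qed
    have W_eq: "W = (\<Union>i. from_nat_into \<F> i)"
      using FW range_from_nat_into[OF False \<F>(2)] by auto
    have meas: "A \<in> sets \<mu>" if "open A" for A using S that by simp
    have "(\<lambda>N. \<integral>x. indicator {x. s N x \<noteq> 0} x * f x \<partial>\<mu>) \<longlonglongrightarrow> (\<integral>x. indicator W x * f x \<partial>\<mu>)"
    proof (rule integral_dominated_convergence[where w = "\<lambda>x. norm (f x)"])
      show "integrable \<mu> (\<lambda>x. norm (f x))" using f by simp
      have [measurable]: "W \<in> sets \<mu>" by (rule meas) fact
      show "(\<lambda>x. indicator W x * f x) \<in> borel_measurable \<mu>" by measurable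
      have [measurable]: "{x. s N x \<noteq> 0} \<in> sets \<mu>" for N
        using Cc_smooth_continuous[OF M s] by (intro meas open_Collect_neq) auto
      show "(\<lambda>x. indicator {x. s N x \<noteq> 0} x * f x) \<in> borel_measurable \<mu>" for N by measurable
      show "AE x in \<mu>. norm (indicator {x. s N x \<noteq> 0} x * f x) \<le> norm (f x)" for N
        by (auto simp: indicator_def)
      have "(\<lambda>N. indicator {x. s N x \<noteq> 0} x * f x) \<longlonglongrightarrow> indicator W x * f x" for x
        unfolding supp W_eq by (intro tendsto_intros LIMSEQ_indicator_UN)
      then show "AE x in \<mu>. (\<lambda>N. indicator {x. s N x \<noteq> 0} x * f x) \<longlonglongrightarrow> indicator W x * f x"
        by simp
    qed
    then show ?thesis
      using integral_indicator_support_eq_0[OF s s0] by (simp add: LIMSEQ_const_iff)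
  qed
qed

text \<open>Dynkin's argument: open sets are intersection-stable and generate the Borel sets. The
  property passes to complements because the integral over \<omega> itself is \<open>0\<close>, and
  to disjoint countable unions by countable additivity.\<close>

lemma integral_indicator_borel_eq_0:
  assumes "A \<in> sets \<mu>"
  shows "(\<integral>x. indicator (A \<inter> \<omega>) x * f x \<partial>\<mu>) = 0"
proof -
  have meas_\<omega>: "\<omega> \<in> sets \<mu>" using S \<omega> by simp
  have int: "integrable \<mu> (\<lambda>x. indicator Y x * f x)" if "Y \<in> sets \<mu>" for Y
    using integrable_mult_indicator[OF that f] by simp
  have "Int_stable {S::'a set. open S}" by (auto simp: Int_stable_def)
  moreover have "{S::'a set. open S} \<subseteq> Pow UNIV" by simp
  moreover have "A \<in> sigma_sets UNIV {S. open S}"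
    using assms S by (simp add: borel_def)
  ultimately show ?thesis
  proof (induction rule: sigma_sets_induct_disjoint)
    case (basic Y)
    then show ?case using \<omega> by (intro integral_indicator_open_eq_0) auto
  next
    case empty
    then show ?case by simp
  next
    case (compl Y)
    have Y: "Y \<in> sets \<mu>" using compl S by (simp add: borel_def)
    have "(\<integral>x. indicator ((UNIV - Y) \<inter> \<omega>) x * f x \<partial>\<mu>) =
        (\<integral>x. indicator \<omega> x * f x - indicator (Y \<inter> \<omega>) x * f x \<partial>\<mu>)"
      by (intro Bochner_Integration.integral_cong) (auto simp: indicator_def)
    also have "\<dots> = 0"
      using Y meas_\<omega> compl integral_indicator_open_eq_0[OF \<omega>(1)]
      by (subst Bochner_Integration.integral_diff) (auto intro!: int)
    finally show ?case .
  next
    case (union Y)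
    have "Y i \<in> sets \<mu>" for i
      using union(2) S by (auto simp: borel_def)
    then have Y: "Y i \<inter> \<omega> \<in> sets \<mu>" for i
      using meas_\<omega> by blast
    have "set_lebesgue_integral \<mu> (\<Union>i. Y i \<inter> \<omega>) f = (\<Sum>i. set_lebesgue_integral \<mu> (Y i \<inter> \<omega>) f)"
    proof (rule lebesgue_integral_countable_add)
      show "set_integrable \<mu> (\<Union>i. Y i \<inter> \<omega>) f"
        unfolding set_integrable_def real_scaleR_def by (intro int sets.countable_UN) (use Y in blast)
      show "Y i \<inter> \<omega> \<inter> (Y j \<inter> \<omega>) = {}" if "i \<noteq> j" for i j
        using union(1) that by (auto simp: disjoint_family_on_def)
    qed (fact Y)
    moreover have "(\<Union>i. Y i \<inter> \<omega>) = (\<Union>i. Y i) \<inter> \<omega>" by blast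
    ultimately show ?case
      using union(3) by (simp add: set_lebesgue_integral_def)
  qed
qed

text \<open>Where \<open>f\<close> is nonnegative, and likewise where it is nonpositive, the
  integrand has one sign, so a zero integral forces it to be null; these two sets cover the
  space.\<close>

lemma AE_eq_0_if_orthogonal_to_Cc_smooth_real: "AE x in \<mu>. x \<in> \<omega> \<longrightarrow> f x = 0"
proof -
  have sp: "space \<mu> = UNIV" using sets_eq_imp_space_eq[OF S] by simp
  have [measurable]: "f \<in> borel_measurable \<mu>" "\<omega> \<in> sets \<mu>" using f S \<omega> by auto
  have "AE x in \<mu>. indicator (A \<inter> \<omega>) x * f x = 0"
    if A: "A \<in> sets \<mu>" and "(\<forall>x\<in>A. 0 \<le> f x) \<or> (\<forall>x\<in>A. f x \<le> 0)" for A
  proof -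
    let ?g = "\<lambda>x. indicator (A \<inter> \<omega>) x * f x"
    have int: "integrable \<mu> ?g" using integrable_mult_indicator[of "A \<inter> \<omega>" \<mu> f] A f by simp
    note zero = integral_indicator_borel_eq_0[OF A]
    from that(2) show ?thesis
    proof
      assume "\<forall>x\<in>A. 0 \<le> f x"
      then have "AE x in \<mu>. 0 \<le> ?g x" by (auto simp: indicator_def)
      then show ?thesis using integral_nonneg_eq_0_iff_AE[OF int] zero by simp
    next
      assume "\<forall>x\<in>A. f x \<le> 0"
      then have "AE x in \<mu>. 0 \<le> - ?g x" by (auto simp: indicator_def)
      then show ?thesis using integral_nonneg_eq_0_iff_AE[of \<mu> "\<lambda>x. - ?g x"] int zero by simp
    qed
  qed
  note * = this
  have m: "{x. 0 \<le> f x} \<in> sets \<mu>" "{x. f x \<le> 0} \<in> sets \<mu>"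
    using measurable_sets[of f \<mu> borel "{0..}"] measurable_sets[of f \<mu> borel "{..0}"] sp
    by (simp_all add: vimage_def)
  show ?thesis
    using *[OF m(1), simplified] *[OF m(2), simplified]
    by eventually_elim (auto simp: indicator_def split: if_splits)
qed

end

text \<open>Test functions are real, so orthogonality splits into real and imaginary parts.\<close>

lemma AE_eq_0_if_orthogonal_to_Cc_smooth:
  fixes f :: "'a::{t2_space, second_countable_topology} \<Rightarrow> complex"
  assumes M: "smooth_manifold B \<A>" and S: "sets \<mu> = sets borel"
    and \<omega>: "open \<omega>" "\<omega> \<subseteq> manifold_interior B \<A>"
    and f: "integrable \<mu> f"
    and orth: "\<And>\<sigma>. \<sigma> \<in> Cc_smooth \<A> \<omega> \<Longrightarrow> (\<integral>x. complex_of_real (\<sigma> x) * f x \<partial>\<mu>) = 0"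
  shows "AE x in \<mu>. x \<in> \<omega> \<longrightarrow> f x = 0"
proof -
  \<comment> \<open>Integrability of the products must be known before the integral commutes with
    \<open>Re\<close> and \<open>Im\<close>.\<close>
  have int: "integrable \<mu> (\<lambda>x. complex_of_real (\<sigma> x) * f x)" if \<sigma>: "\<sigma> \<in> Cc_smooth \<A> \<omega>" for \<sigma>
  proof -
    have "integrable \<mu> (\<lambda>x. \<sigma> x * Re (f x))" "integrable \<mu> (\<lambda>x. \<sigma> x * Im (f x))"
      using f by (auto intro!: Cc_smooth_mult_integrable[OF M S \<sigma>])
    then have "integrable \<mu> (\<lambda>x. complex_of_real (\<sigma> x * Re (f x)) + \<i> * complex_of_real (\<sigma> x * Im (f x)))"
      by (intro Bochner_Integration.integrable_add integrable_mult_right integrable_of_real)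
    then show ?thesis
      by (rule Bochner_Integration.integrable_cong[OF refl, THEN iffD1, rotated])
        (simp add: complex_eq_iff)
  qed
  have "(\<integral>x. \<sigma> x * Re (f x) \<partial>\<mu>) = 0" "(\<integral>x. \<sigma> x * Im (f x) \<partial>\<mu>) = 0"
    if \<sigma>: "\<sigma> \<in> Cc_smooth \<A> \<omega>" for \<sigma>
    using integral_Re[OF int[OF \<sigma>]] integral_Im[OF int[OF \<sigma>]] orth[OF \<sigma>] by simp_all
  then have "AE x in \<mu>. x \<in> \<omega> \<longrightarrow> Re (f x) = 0" "AE x in \<mu>. x \<in> \<omega> \<longrightarrow> Im (f x) = 0"
    using f by (auto intro!: AE_eq_0_if_orthogonal_to_Cc_smooth_real[OF M S \<omega>])
  then show ?thesis by eventually_elim (auto simp: complex_eq_iff)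
qed

section \<open>Square-integrable functions\<close>

lemma L2_mult_cnj_integrable:
  assumes f: "f \<in> L2 M" and g: "g \<in> L2 M"
  shows "integrable M (\<lambda>x. f x * cnj (g x))"
proof (rule Bochner_Integration.integrable_bound)
  show "integrable M (\<lambda>x. (cmod (f x))\<^sup>2 + (cmod (g x))\<^sup>2)"
    using f g by (simp add: L2_def)
  have [measurable]: "cnj \<in> borel_measurable borel"
    by (intro borel_measurable_continuous_onI continuous_intros)
  have "f \<in> borel_measurable M" "g \<in> borel_measurable M" using f g by (simp_all add: L2_def)
  then show "(\<lambda>x. f x * cnj (g x)) \<in> borel_measurable M" by measurable
  have "cmod (f x) * cmod (g x) \<le> (cmod (f x))\<^sup>2 + (cmod (g x))\<^sup>2" for x
    using sum_squares_bound[of "cmod (f x)" "cmod (g x)"]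
      mult_nonneg_nonneg[OF norm_ge_zero[of "f x"] norm_ge_zero[of "g x"]] by linarith
  then show "AE x in M. norm (f x * cnj (g x)) \<le> norm ((cmod (f x))\<^sup>2 + (cmod (g x))\<^sup>2)"
    by (simp add: norm_mult)
qed

lemma L2_scale:
  assumes "f \<in> L2 M"
  shows "(\<lambda>x. c * f x) \<in> L2 M"
  using assms by (auto simp: L2_def norm_mult power_mult_distrib)

lemma L2_add:
  assumes f: "f \<in> L2 M" and g: "g \<in> L2 M"
  shows "(\<lambda>x. f x + g x) \<in> L2 M"
proof -
  have [measurable]: "f \<in> borel_measurable M" "g \<in> borel_measurable M"
    using f g by (simp_all add: L2_def)
  have "integrable M (\<lambda>x. (cmod (f x + g x))\<^sup>2)"
  proof (rule Bochner_Integration.integrable_bound)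
    show "integrable M (\<lambda>x. 2 * (cmod (f x))\<^sup>2 + 2 * (cmod (g x))\<^sup>2)"
      using f g by (simp add: L2_def)
    have "(cmod (f x + g x))\<^sup>2 \<le> 2 * (cmod (f x))\<^sup>2 + 2 * (cmod (g x))\<^sup>2" for x
      using power_mono[OF norm_triangle_ineq[of "f x" "g x"], of 2]
        sum_squares_bound[of "cmod (f x)" "cmod (g x)"]
      by (simp add: power2_sum)
    then show "AE x in M. norm ((cmod (f x + g x))\<^sup>2) \<le> norm (2 * (cmod (f x))\<^sup>2 + 2 * (cmod (g x))\<^sup>2)"
      by simp
  qed measurable
  then show ?thesis by (simp add: L2_def)
qed

lemma L2_diff:
  assumes "f \<in> L2 M" "g \<in> L2 M"
  shows "(\<lambda>x. f x - g x) \<in> L2 M"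
  using L2_add[OF assms(1) L2_scale[OF assms(2), of "-1"]] by simp

lemma L2_sum:
  fixes n :: nat
  assumes "\<And>i. i < n \<Longrightarrow> b i \<in> L2 M"
  shows "(\<lambda>x. \<Sum>i<n. c i * b i x) \<in> L2 M"
  using assms
proof (induction n)
  case 0
  then show ?case by (simp add: L2_def)
next
  case (Suc n)
  then show ?case by (simp add: L2_add L2_scale)
qed

lemma L2_inner_commute: "L2_inner M g f = cnj (L2_inner M f g)"
  unfolding L2_inner_def by (subst Bochner_Integration.integral_cnj[symmetric]) (simp add: mult.commute)

lemma L2_inner_diff_left:
  assumes "f \<in> L2 M" "g \<in> L2 M" "h \<in> L2 M"
  shows "L2_inner M (\<lambda>x. f x - g x) h = L2_inner M f h - L2_inner M g h"
  using L2_mult_cnj_integrable[OF assms(1,3)] L2_mult_cnj_integrable[OF assms(2,3)]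
  by (simp add: L2_inner_def left_diff_distrib)

lemma L2_inner_add_right:
  assumes "f \<in> L2 M" "g \<in> L2 M" "h \<in> L2 M"
  shows "L2_inner M f (\<lambda>x. g x + h x) = L2_inner M f g + L2_inner M f h"
  using L2_mult_cnj_integrable[OF assms(1,2)] L2_mult_cnj_integrable[OF assms(1,3)]
  by (simp add: L2_inner_def ring_distribs)

lemma L2_inner_scale_left: "L2_inner M (\<lambda>x. c * f x) g = c * L2_inner M f g"
  by (simp add: L2_inner_def mult.assoc)

lemma L2_inner_scale_right: "L2_inner M f (\<lambda>x. c * g x) = cnj c * L2_inner M f g"
  by (simp add: L2_inner_def mult.left_commute)

lemma L2_inner_cong_AE:
  assumes "f \<in> L2 M" "f' \<in> L2 M" "g \<in> L2 M" "g' \<in> L2 M"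
    "AE x in M. f x = f' x" "AE x in M. g x = g' x"
  shows "L2_inner M f g = L2_inner M f' g'"
  unfolding L2_inner_def
proof (rule integral_cong_AE)
  show "AE x in M. f x * cnj (g x) = f' x * cnj (g' x)"
    using assms(5,6) by eventually_elim simp
qed (use assms in \<open>auto intro!: borel_measurable_integrable L2_mult_cnj_integrable\<close>)

lemma L2_inner_sum_right:
  fixes n :: nat
  assumes "f \<in> L2 M" "\<And>i. i < n \<Longrightarrow> b i \<in> L2 M"
  shows "L2_inner M f (\<lambda>x. \<Sum>i<n. c i * b i x) = (\<Sum>i<n. cnj (c i) * L2_inner M f (b i))"
  using assms(2)
proof (induction n)
  case 0
  then show ?case by (simp add: L2_inner_def)
next
  case (Suc n)
  then show ?case
    using assms(1) by (simp add: L2_inner_add_right L2_sum L2_scale L2_inner_scale_right)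
qed

lemma L2_inner_self_eq_0_iff:
  assumes "f \<in> L2 M"
  shows "L2_inner M f f = 0 \<longleftrightarrow> (AE x in M. f x = 0)"
proof -
  have "L2_inner M f f = complex_of_real (\<integral>x. (cmod (f x))\<^sup>2 \<partial>M)"
    by (simp add: L2_inner_def complex_norm_square[symmetric] del: of_real_power)
  moreover have "integrable M (\<lambda>x. (cmod (f x))\<^sup>2)" using assms by (simp add: L2_def)
  ultimately show ?thesis
    using integral_nonneg_eq_0_iff_AE[of M "\<lambda>x. (cmod (f x))\<^sup>2"] by simp
qed

lemma L2_inner_AE_zero_right:
  assumes "f \<in> L2 M" "g \<in> L2 M" "AE x in M. g x = 0"
  shows "L2_inner M f g = 0"
proof -
  have "L2_inner M f g = L2_inner M f (\<lambda>x. 0 * g x)"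
    by (rule L2_inner_cong_AE) (use assms L2_scale[OF assms(2), of 0] in auto)
  then show ?thesis by (simp add: L2_inner_def)
qed

section \<open>Orthogonal components and projections\<close>

lemma ex_L2_component:
  assumes "f \<in> L2 M" "g \<in> L2 M"
  shows "\<exists>\<alpha>. L2_inner M (\<lambda>x. f x - \<alpha> * g x) g = 0"
proof (cases "L2_inner M g g = 0")
  \<comment> \<open>A null \<open>g\<close> is orthogonal to everything, so the coefficient
    \<open>0\<close> serves. This case is what permits dependent families in the Gram-Schmidt
    argument.\<close>
  case True
  then have "L2_inner M (\<lambda>x. f x - 0 * g x) g = 0"
    using assms by (intro L2_inner_AE_zero_right) (auto simp: L2_inner_self_eq_0_iff)
  then show ?thesis ..
next
  case False
  define \<alpha> where "\<alpha> = L2_inner M f g / L2_inner M g g"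
  have "L2_inner M (\<lambda>x. f x - \<alpha> * g x) g = L2_inner M f g - \<alpha> * L2_inner M g g"
    using assms L2_scale[OF assms(2)] by (simp add: L2_inner_diff_left L2_inner_scale_left)
  also have "\<dots> = 0" using False by (simp add: \<alpha>_def)
  finally have "L2_inner M (\<lambda>x. f x - \<alpha> * g x) g = 0" .
  then show ?thesis ..
qed

text \<open>Gram--Schmidt; the \<open>b i\<close> may be linearly dependent.\<close>

lemma ex_L2_projection_on_span:
  fixes n :: nat
  assumes "\<And>i. i < n \<Longrightarrow> b i \<in> L2 M" "f \<in> L2 M"
  shows "\<exists>c. \<forall>j<n. L2_inner M (\<lambda>x. f x - (\<Sum>i<n. c i * b i x)) (b j) = 0"
  using assms
proof (induction n arbitrary: f)
  case 0
  then show ?case by simp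
next
  case (Suc n)
  have b: "b i \<in> L2 M" if "i \<le> n" for i using Suc.prems(1) that by simp
  \<comment> \<open>The induction hypothesis is used twice, for \<open>f\<close> and for the new
    vector \<open>b n\<close>; the residual \<open>r\<close> of the latter is the only new direction
    to remove.\<close>
  obtain c where c: "\<forall>j<n. L2_inner M (\<lambda>x. f x - (\<Sum>i<n. c i * b i x)) (b j) = 0"
    using Suc.IH[OF b Suc.prems(2)] by auto
  obtain d where d: "\<forall>j<n. L2_inner M (\<lambda>x. b n x - (\<Sum>i<n. d i * b i x)) (b j) = 0"
    using Suc.IH[OF b b] by auto
  define q where "q = (\<lambda>x. \<Sum>i<n. d i * b i x)"
  define r where "r = (\<lambda>x. b n x - q x)"
  define g where "g = (\<lambda>x. f x - (\<Sum>i<n. c i * b i x))"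
  have L2: "q \<in> L2 M" "r \<in> L2 M" "g \<in> L2 M"
    unfolding q_def r_def g_def using b Suc.prems(2) by (auto intro!: L2_sum L2_diff)
  obtain \<alpha> where \<alpha>: "L2_inner M (\<lambda>x. g x - \<alpha> * r x) r = 0"
    using ex_L2_component[OF L2(3,2)] by blast
  define h where "h = (\<lambda>x. g x - \<alpha> * r x)"
  have h: "h \<in> L2 M" unfolding h_def using L2 by (intro L2_diff L2_scale)
  have hb: "L2_inner M h (b j) = 0" if "j < n" for j
    using c d that L2 b[of j] unfolding h_def
    by (subst L2_inner_diff_left) (auto simp: L2_inner_scale_left g_def r_def q_def intro: L2_scale)
  \<comment> \<open>\<open>b n\<close> is \<open>r + q\<close> with \<open>q\<close> a combination
    of the earlier vectors; orthogonality to both parts gives orthogonality to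
    \<open>b n\<close>.\<close>
  have "L2_inner M h q = 0"
    unfolding q_def using hb h b by (subst L2_inner_sum_right) auto
  then have "L2_inner M h (\<lambda>x. r x + q x) = 0"
    using \<alpha> h L2 by (subst L2_inner_add_right) (auto simp: h_def)
  then have hbn: "L2_inner M h (b n) = 0" by (simp add: r_def)
  \<comment> \<open>Expanding \<open>f - sum c b - \<alpha> (b n - sum d b)\<close> gives
    \<open>b n\<close> the coefficient \<alpha> and corrects each earlier \<open>c i\<close> by
    \<open>\<alpha> * d i\<close>.\<close>
  have "h = (\<lambda>x. f x - (\<Sum>i<Suc n. (if i = n then \<alpha> else c i - \<alpha> * d i) * b i x))"
    by (rule ext) (simp add: h_def g_def r_def q_def algebra_simps sum_subtractf sum_distrib_left)
  then show ?case
    using hb hbn by (intro exI[of _ "\<lambda>i. if i = n then \<alpha> else c i - \<alpha> * d i"])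
      (auto simp: less_Suc_eq)
qed

lemma L2_subspace_sum:
  fixes n :: nat
  assumes "L2_subspace M E" "\<And>i. i < n \<Longrightarrow> b i \<in> E"
  shows "(\<lambda>x. \<Sum>i<n. c i * b i x) \<in> E"
  using assms(2)
proof (induction n)
  case 0
  then show ?case using assms(1) by (simp add: L2_subspace_def)
next
  case (Suc n)
  then show ?case using assms(1) by (simp add: L2_subspace_def)
qed

text \<open>The choice in \<open>L2_proj_def\<close> has a witness: a residual orthogonal to a
  finite basis is orthogonal to each \<open>v\<close> in \<open>E\<close>, since \<open>v\<close> is
  a.e. a combination of that basis.\<close>

lemma L2_proj:
  assumes E: "L2_subspace M E" "L2_has_dim M E n" and f: "f \<in> L2 M"
  shows "L2_proj M E f \<in> E"
    and "\<And>v. v \<in> E \<Longrightarrow> L2_inner M (\<lambda>x. f x - L2_proj M E f x) v = 0"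
proof -
  from E(2) obtain b where b: "\<And>i. i < n \<Longrightarrow> b i \<in> E"
    "\<And>u. u \<in> E \<Longrightarrow> \<exists>c. AE x in M. u x = (\<Sum>i<n. c i * b i x)"
    unfolding L2_has_dim_def by blast
  have EL2: "E \<subseteq> L2 M" using E(1) by (simp add: L2_subspace_def)
  then have bL2: "\<And>i. i < n \<Longrightarrow> b i \<in> L2 M" using b(1) by blast
  obtain c where c: "\<And>j. j < n \<Longrightarrow> L2_inner M (\<lambda>x. f x - (\<Sum>i<n. c i * b i x)) (b j) = 0"
    using ex_L2_projection_on_span[where b = b and n = n, OF bL2 f] by auto
  have "L2_inner M (\<lambda>x. f x - (\<Sum>i<n. c i * b i x)) v = 0" if v: "v \<in> E" for v
  proof -
    obtain d where d: "AE x in M. v x = (\<Sum>i<n. d i * b i x)" using b(2) v by blast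
    let ?g = "\<lambda>x. f x - (\<Sum>i<n. c i * b i x)"
    have g: "?g \<in> L2 M" using f bL2 by (intro L2_diff L2_sum)
    have "L2_inner M ?g v = L2_inner M ?g (\<lambda>x. \<Sum>i<n. d i * b i x)"
      using v EL2 d g bL2 by (intro L2_inner_cong_AE L2_sum) auto
    also have "\<dots> = 0"
      using c by (subst L2_inner_sum_right[OF g bL2]) auto
    finally show ?thesis .
  qed
  with L2_subspace_sum[OF E(1), of n b c] b(1)
  have "\<exists>p. p \<in> E \<and> (\<forall>v\<in>E. L2_inner M (\<lambda>x. f x - p x) v = 0)" by auto
  from someI_ex[OF this]
  show "L2_proj M E f \<in> E" "\<And>v. v \<in> E \<Longrightarrow> L2_inner M (\<lambda>x. f x - L2_proj M E f x) v = 0"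
    unfolding L2_proj_def by blast+
qed

text \<open>Otherwise removing the component along \<open>u\<close> from an element of
  \<open>E\<close> always leaves a null function, so all basis elements are multiples of
  \<open>u\<close> and two of them are dependent.\<close>

lemma L2_has_dim_ge_2_orthogonal:
  assumes E: "L2_subspace M E" "L2_has_dim M E n" "2 \<le> n" and u: "u \<in> E"
  obtains v where "v \<in> E" "L2_inner M v u = 0" "\<not> (AE x in M. v x = 0)"
proof (rule ccontr)
  assume "\<not> thesis"
  with that have contra: "AE x in M. v x = 0" if "v \<in> E" "L2_inner M v u = 0" for v
    using that by blast
  from E(2) obtain b where b: "\<And>i. i < n \<Longrightarrow> b i \<in> E"
    "\<And>c i. AE x in M. (\<Sum>i<n. c i * b i x) = 0 \<Longrightarrow> i < n \<Longrightarrow> c i = 0"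
    unfolding L2_has_dim_def by blast
  have EL2: "E \<subseteq> L2 M" using E(1) by (simp add: L2_subspace_def)
  have multiple: "\<exists>\<alpha>. AE x in M. b i x = \<alpha> * u x" if "i < n" for i
  proof -
    obtain \<alpha> where \<alpha>: "L2_inner M (\<lambda>x. b i x - \<alpha> * u x) u = 0"
      using ex_L2_component b(1)[OF \<open>i < n\<close>] u EL2 by blast
    have "(\<lambda>x. (- \<alpha>) * u x) \<in> E"
      using E(1) u by (simp only: L2_subspace_def)
    then have "(\<lambda>x. b i x + (- \<alpha>) * u x) \<in> E"
      using E(1) b(1)[OF \<open>i < n\<close>] by (simp only: L2_subspace_def)
    with \<alpha> have "AE x in M. b i x - \<alpha> * u x = 0" by (intro contra) simp_all
    then show ?thesis by (intro exI[of _ \<alpha>]) simp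
  qed
  obtain \<alpha> where \<alpha>: "AE x in M. b 0 x = \<alpha> * u x"
    using multiple[of 0] \<open>2 \<le> n\<close> by auto
  obtain \<beta> where \<beta>: "AE x in M. b 1 x = \<beta> * u x"
    using multiple[of 1] \<open>2 \<le> n\<close> by auto
  \<comment> \<open>A combination of \<open>b 0\<close> and \<open>b 1\<close> is padded with zero
    coefficients to match the sums in \<open>L2_has_dim\<close>.\<close>
  have two: "(\<Sum>i<n. (if i = 0 then s else if i = 1 then t else 0) * b i x) = s * b 0 x + t * b 1 x"
    for s t x
  proof -
    have "(\<Sum>i<n. (if i = 0 then s else if i = 1 then t else 0) * b i x) =
        (\<Sum>i\<in>{0, 1}. (if i = 0 then s else if i = 1 then t else 0) * b i x)"
      using \<open>2 \<le> n\<close> by (intro sum.mono_neutral_right) auto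
    then show ?thesis by simp
  qed
  have indep: "s = 0 \<and> t = 0" if "AE x in M. s * b 0 x + t * b 1 x = 0" for s t
    using b(2)[of "\<lambda>i. if i = 0 then s else if i = 1 then t else 0" 0]
      b(2)[of "\<lambda>i. if i = 0 then s else if i = 1 then t else 0" 1] that \<open>2 \<le> n\<close>
    unfolding two by simp
  \<comment> \<open>This relation forces \<alpha> = 0, so \<open>b 0\<close> is null, and the
    coefficients \<open>1\<close> and \<open>0\<close> then contradict independence.\<close>
  have "AE x in M. \<beta> * b 0 x + (- \<alpha>) * b 1 x = 0"
    using \<alpha> \<beta> by eventually_elim simp
  from indep[OF this] have "\<alpha> = 0" by simp
  with \<alpha> have "AE x in M. 1 * b 0 x + 0 * b 1 x = 0" by simp
  from indep[OF this] show False by simp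
qed

section \<open>Local perturbations of a degenerate eigenspace\<close>

lemma AE_restrict_space_borel:
  assumes "sets \<mu> = sets borel" "open \<omega>"
  shows "(AE x in restrict_space \<mu> \<omega>. P x) \<longleftrightarrow> (AE x in \<mu>. x \<in> \<omega> \<longrightarrow> P x)"
  using assms sets_eq_imp_space_eq[OF assms(1)] by (intro AE_restrict_space_iff) auto

lemma L2_restrict_space:
  assumes "sets \<mu> = sets borel" "open \<omega>" "f \<in> L2 \<mu>"
  shows "f \<in> L2 (restrict_space \<mu> \<omega>)"
proof -
  have \<omega>: "\<omega> \<inter> space \<mu> \<in> sets \<mu>" using assms(1,2) sets_eq_imp_space_eq[OF assms(1)] by simp
  have "integrable \<mu> (\<lambda>x. (cmod (f x))\<^sup>2)" using assms(3) by (simp add: L2_def)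
  then have "integrable \<mu> (\<lambda>x. indicator \<omega> x *\<^sub>R (cmod (f x))\<^sup>2)"
    using \<omega> sets_eq_imp_space_eq[OF assms(1)] by (intro integrable_mult_indicator) auto
  then have "integrable (restrict_space \<mu> \<omega>) (\<lambda>x. (cmod (f x))\<^sup>2)"
    using \<omega> by (subst integrable_restrict_space) auto
  then show ?thesis
    using assms(3) by (auto simp: L2_def intro: measurable_restrict_space1)
qed

text \<open>Trades the restricted measure space for a condition on \<mu>, the form in which the test
  function argument delivers its conclusion.\<close>

lemma L2_restrict_eq_zero_iff:
  assumes S: "sets \<mu> = sets borel" "open \<omega>" and E: "L2_subspace \<mu> E"
  shows "L2_restrict \<mu> \<omega> E = L2_zero (restrict_space \<mu> \<omega>) \<longleftrightarrow>
    (\<forall>u\<in>E. AE x in \<mu>. x \<in> \<omega> \<longrightarrow> u x = 0)"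
proof
  assume *: "L2_restrict \<mu> \<omega> E = L2_zero (restrict_space \<mu> \<omega>)"
  show "\<forall>u\<in>E. AE x in \<mu>. x \<in> \<omega> \<longrightarrow> u x = 0"
  proof
    fix u assume u: "u \<in> E"
    then have "u \<in> L2 \<mu>" using E by (auto simp: L2_subspace_def)
    then have "u \<in> L2_restrict \<mu> \<omega> E"
      using u L2_restrict_space[OF S] by (auto simp: L2_restrict_def)
    then show "AE x in \<mu>. x \<in> \<omega> \<longrightarrow> u x = 0"
      by (simp add: * L2_zero_def AE_restrict_space_borel[OF S])
  qed
next
  assume *: "\<forall>u\<in>E. AE x in \<mu>. x \<in> \<omega> \<longrightarrow> u x = 0"
  have "(\<lambda>x. 0) \<in> E" using E by (simp add: L2_subspace_def)
  then have "L2_zero (restrict_space \<mu> \<omega>) \<subseteq> L2_restrict \<mu> \<omega> E"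
    by (auto simp: L2_zero_def L2_restrict_def)
  moreover have "v \<in> L2_zero (restrict_space \<mu> \<omega>)" if "v \<in> L2_restrict \<mu> \<omega> E" for v
  proof -
    from that obtain u where u: "u \<in> E" "v \<in> L2 (restrict_space \<mu> \<omega>)"
      "AE x in restrict_space \<mu> \<omega>. v x = u x" by (auto simp: L2_restrict_def)
    have "AE x in restrict_space \<mu> \<omega>. u x = 0"
      using * u(1) by (simp add: AE_restrict_space_borel[OF S])
    with u(3) have "AE x in restrict_space \<mu> \<omega>. v x = 0" by eventually_elim simp
    with u(2) show ?thesis by (simp add: L2_zero_def)
  qed
  ultimately show "L2_restrict \<mu> \<omega> E = L2_zero (restrict_space \<mu> \<omega>)" by blast
qed

lemma mult_op_L2:
  fixes \<A> :: "('a::{t2_space, second_countable_topology}, 'b::euclidean_space) chart set"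
  assumes M: "smooth_manifold B \<A>" and S: "sets \<mu> = sets borel"
    and \<sigma>: "\<sigma> \<in> Cc_smooth \<A> \<omega>" and u: "u \<in> L2 \<mu>"
  shows "mult_op \<sigma> u \<in> L2 \<mu>"
proof -
  obtain C where C: "0 \<le> C" "\<And>x. \<bar>\<sigma> x\<bar> \<le> C"
    using Cc_smooth_bounded[OF M \<sigma>] by blast
  have [measurable]: "\<sigma> \<in> borel_measurable \<mu>" "u \<in> borel_measurable \<mu>"
    using borel_measurable_continuous_onI[OF Cc_smooth_continuous[OF M \<sigma>]] u S
    by (simp_all add: L2_def cong: measurable_cong_sets)
  have "integrable \<mu> (\<lambda>x. (cmod (complex_of_real (\<sigma> x) * u x))\<^sup>2)"
  proof (rule Bochner_Integration.integrable_bound)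
    show "integrable \<mu> (\<lambda>x. C\<^sup>2 * (cmod (u x))\<^sup>2)" using u by (simp add: L2_def)
    have "(\<sigma> x)\<^sup>2 \<le> C\<^sup>2" for x
      using power_mono[OF C(2)[of x] abs_ge_zero, of 2] by simp
    then show "AE x in \<mu>. norm ((cmod (complex_of_real (\<sigma> x) * u x))\<^sup>2) \<le> norm (C\<^sup>2 * (cmod (u x))\<^sup>2)"
      by (auto simp: norm_mult power_mult_distrib intro!: mult_right_mono)
  qed measurable
  then show ?thesis by (simp add: L2_def mult_op_def)
qed

text \<open>\<open>T u\<close> and its projection differ by something orthogonal to
  \<open>E\<close>, so the projection disappears in inner products with elements of
  \<open>E\<close>. This turns the operator hypothesis into an identity of integrals.\<close>

lemma real_scalar_on_L2_projD:
  assumes E: "L2_subspace M E" "L2_has_dim M E n"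
    and T: "\<And>u. u \<in> E \<Longrightarrow> T u \<in> L2 M" and "real_scalar_on M E (\<lambda>u. L2_proj M E (T u))"
  obtains c :: real
    where "\<And>u v. u \<in> E \<Longrightarrow> v \<in> E \<Longrightarrow> L2_inner M (T u) v = complex_of_real c * L2_inner M u v"
proof -
  obtain c :: real where
    c: "\<And>u. u \<in> E \<Longrightarrow> AE x in M. L2_proj M E (T u) x = complex_of_real c * u x"
    using assms(4) unfolding real_scalar_on_def by blast
  have EL2: "E \<subseteq> L2 M" using E(1) by (simp add: L2_subspace_def)
  have "L2_inner M (T u) v = complex_of_real c * L2_inner M u v" if uv: "u \<in> E" "v \<in> E" for u v
  proof -
    note P = L2_proj[OF E T[OF uv(1)]]
    have "L2_inner M (T u) v = L2_inner M (L2_proj M E (T u)) v"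
      using P(2)[OF uv(2)] L2_inner_diff_left[of "T u" M "L2_proj M E (T u)" v] T P(1) uv EL2
      by auto
    also have "\<dots> = L2_inner M (\<lambda>x. complex_of_real c * u x) v"
      using P(1) uv EL2 c by (intro L2_inner_cong_AE L2_scale) auto
    finally show ?thesis by (simp add: L2_inner_scale_left)
  qed
  then show ?thesis by (rule that)
qed

lemma ex_nonscalar_compression_iff:
  fixes \<A> :: "('a::{t2_space, second_countable_topology}, 'b::euclidean_space) chart set"
  assumes M: "smooth_manifold B \<A>" and S: "sets \<mu> = sets borel"
    and \<omega>: "open \<omega>" "\<omega> \<subseteq> manifold_interior B \<A>"
    and E: "L2_subspace \<mu> E" "L2_has_dim \<mu> E n" "2 \<le> n"
  shows "(\<exists>\<sigma>\<in>Cc_smooth \<A> \<omega>. \<not> real_scalar_on \<mu> E (\<lambda>u. L2_proj \<mu> E (mult_op \<sigma> u))) \<longleftrightarrow>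
    L2_restrict \<mu> \<omega> E \<noteq> L2_zero (restrict_space \<mu> \<omega>)"
  unfolding L2_restrict_eq_zero_iff[OF S \<omega>(1) E(1)]
proof
  have EL2: "E \<subseteq> L2 \<mu>" using E(1) by (simp add: L2_subspace_def)
  {
    assume "\<exists>\<sigma>\<in>Cc_smooth \<A> \<omega>. \<not> real_scalar_on \<mu> E (\<lambda>u. L2_proj \<mu> E (mult_op \<sigma> u))"
    then obtain \<sigma> where \<sigma>: "\<sigma> \<in> Cc_smooth \<A> \<omega>"
      and nonscalar: "\<not> real_scalar_on \<mu> E (\<lambda>u. L2_proj \<mu> E (mult_op \<sigma> u))" by blast
    show "\<not> (\<forall>u\<in>E. AE x in \<mu>. x \<in> \<omega> \<longrightarrow> u x = 0)"
    proof
      assume *: "\<forall>u\<in>E. AE x in \<mu>. x \<in> \<omega> \<longrightarrow> u x = 0"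
      \<comment> \<open>As \<open>u\<close> vanishes on \<omega>, \<open>\<sigma> u\<close> is null,
        and its projection \<open>p\<close> satisfies \<open><p, p> = <\<sigma> u, p> = 0\<close>;
        the compression is the scalar \<open>0\<close>.\<close>
      have "AE x in \<mu>. L2_proj \<mu> E (mult_op \<sigma> u) x = complex_of_real 0 * u x" if u: "u \<in> E" for u
      proof -
        have m: "mult_op \<sigma> u \<in> L2 \<mu>" using mult_op_L2[OF M S \<sigma>] u EL2 by blast
        note P = L2_proj[OF E(1,2) m]
        define p where "p = L2_proj \<mu> E (mult_op \<sigma> u)"
        have p: "p \<in> E" "p \<in> L2 \<mu>" using P(1) EL2 by (auto simp: p_def)
        have "AE x in \<mu>. x \<in> \<omega> \<longrightarrow> u x = 0" using * u by blast
        then have "AE x in \<mu>. mult_op \<sigma> u x = 0"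
          by eventually_elim (auto simp: mult_op_def Cc_smooth_zero_outside[OF \<sigma>])
        then have "L2_inner \<mu> p (mult_op \<sigma> u) = 0"
          by (rule L2_inner_AE_zero_right[OF p(2) m])
        then have "L2_inner \<mu> (mult_op \<sigma> u) p = 0"
          by (subst L2_inner_commute) simp
        then have "L2_inner \<mu> p p = 0"
          using P(2)[OF p(1)] L2_inner_diff_left[OF m p(2) p(2)] by (simp add: p_def)
        then show ?thesis using L2_inner_self_eq_0_iff[OF p(2)] by (simp add: p_def)
      qed
      with nonscalar show False unfolding real_scalar_on_def by blast
    qed
  }
  {
    assume "\<not> (\<forall>u\<in>E. AE x in \<mu>. x \<in> \<omega> \<longrightarrow> u x = 0)"
    then obtain u where u: "u \<in> E" "\<not> (AE x in \<mu>. x \<in> \<omega> \<longrightarrow> u x = 0)" by blast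
    show "\<exists>\<sigma>\<in>Cc_smooth \<A> \<omega>. \<not> real_scalar_on \<mu> E (\<lambda>u. L2_proj \<mu> E (mult_op \<sigma> u))"
    proof (rule ccontr)
      assume "\<not> ?thesis"
      then have scalar: "real_scalar_on \<mu> E (\<lambda>u. L2_proj \<mu> E (mult_op \<sigma> u))"
        if "\<sigma> \<in> Cc_smooth \<A> \<omega>" for \<sigma> using that by blast
      obtain v where v: "v \<in> E" "L2_inner \<mu> v u = 0" "\<not> (AE x in \<mu>. v x = 0)"
        using L2_has_dim_ge_2_orthogonal[OF E u(1)] by blast
      have uv: "u \<in> L2 \<mu>" "v \<in> L2 \<mu>" using u v EL2 by auto
      \<comment> \<open>For fixed \<sigma> one constant serves all pairs \<open>f, g\<close>. Its
        value is unknown, so the combinations tested below are built to make it drop out.\<close>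
      have inner: "\<exists>c. \<forall>f\<in>E. \<forall>g\<in>E.
          (\<integral>x. complex_of_real (\<sigma> x) * (f x * cnj (g x)) \<partial>\<mu>) = c * L2_inner \<mu> f g"
        if \<sigma>: "\<sigma> \<in> Cc_smooth \<A> \<omega>" for \<sigma>
      proof -
        have "mult_op \<sigma> f \<in> L2 \<mu>" if "f \<in> E" for f
          using mult_op_L2[OF M S \<sigma>] EL2 that by blast
        then obtain c :: real where "\<And>f g. f \<in> E \<Longrightarrow> g \<in> E \<Longrightarrow>
            L2_inner \<mu> (mult_op \<sigma> f) g = complex_of_real c * L2_inner \<mu> f g"
          using real_scalar_on_L2_projD[OF E(1,2) _ scalar[OF \<sigma>]] by metis
        then show ?thesis by (auto simp: L2_inner_def mult_op_def mult.assoc)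
      qed
      have int: "integrable \<mu> (\<lambda>x. v x * cnj (u x))" "integrable \<mu> (\<lambda>x. u x * cnj (u x))"
        "integrable \<mu> (\<lambda>x. v x * cnj (v x))"
        using uv by (auto intro: L2_mult_cnj_integrable)
      have "AE x in \<mu>. x \<in> \<omega> \<longrightarrow> v x * cnj (u x) = 0"
      proof (rule AE_eq_0_if_orthogonal_to_Cc_smooth[OF M S \<omega> int(1)])
        show "(\<integral>x. complex_of_real (\<sigma> x) * (v x * cnj (u x)) \<partial>\<mu>) = 0"
          if "\<sigma> \<in> Cc_smooth \<A> \<omega>" for \<sigma>
          using inner[OF that] u(1) v(1,2) by auto
      qed
      \<comment> \<open>Tested against \<sigma>, each of the two terms yields
        \<open>c <u, u> <v, v>\<close>, so the difference is orthogonal to every test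
        function.\<close>
      moreover have "AE x in \<mu>. x \<in> \<omega> \<longrightarrow>
          L2_inner \<mu> v v * (u x * cnj (u x)) - L2_inner \<mu> u u * (v x * cnj (v x)) = 0"
      proof (rule AE_eq_0_if_orthogonal_to_Cc_smooth[OF M S \<omega>])
        show "integrable \<mu> (\<lambda>x. L2_inner \<mu> v v * (u x * cnj (u x)) - L2_inner \<mu> u u * (v x * cnj (v x)))"
          using int by simp
        fix \<sigma> assume \<sigma>: "\<sigma> \<in> Cc_smooth \<A> \<omega>"
        have int': "integrable \<mu> (\<lambda>x. complex_of_real (\<sigma> x) * (f x * cnj (f x)))" if "f \<in> L2 \<mu>" for f
          using L2_mult_cnj_integrable[OF mult_op_L2[OF M S \<sigma> that] that]
          by (simp add: mult_op_def mult.assoc)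
        obtain c where c: "\<And>f. f \<in> E \<Longrightarrow>
            (\<integral>x. complex_of_real (\<sigma> x) * (f x * cnj (f x)) \<partial>\<mu>) = c * L2_inner \<mu> f f"
          using inner[OF \<sigma>] by blast
        have "(\<integral>x. complex_of_real (\<sigma> x) *
              (L2_inner \<mu> v v * (u x * cnj (u x)) - L2_inner \<mu> u u * (v x * cnj (v x))) \<partial>\<mu>) =
            (\<integral>x. L2_inner \<mu> v v * (complex_of_real (\<sigma> x) * (u x * cnj (u x))) -
              L2_inner \<mu> u u * (complex_of_real (\<sigma> x) * (v x * cnj (v x))) \<partial>\<mu>)"
          by (intro Bochner_Integration.integral_cong) (auto simp: algebra_simps)
        also have "\<dots> = L2_inner \<mu> v v * (c * L2_inner \<mu> u u) - L2_inner \<mu> u u * (c * L2_inner \<mu> v v)"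
          using int'[OF uv(1)] int'[OF uv(2)] c[OF u(1)] c[OF v(1)] by simp
        finally show "(\<integral>x. complex_of_real (\<sigma> x) *
              (L2_inner \<mu> v v * (u x * cnj (u x)) - L2_inner \<mu> u u * (v x * cnj (v x))) \<partial>\<mu>) = 0"
          by simp
      qed
      \<comment> \<open>Pointwise on \<omega>, either \<open>u x = 0\<close> or
        \<open>v x = 0\<close>; in the second case the weighted identity reduces to
        \<open><v, v> |u x|^2 = 0\<close> with \<open><v, v>\<close> nonzero.\<close>
      ultimately have "AE x in \<mu>. x \<in> \<omega> \<longrightarrow> u x = 0"
      proof eventually_elim
        case (elim x)
        then show ?case
          using v(3) L2_inner_self_eq_0_iff[OF uv(2)] by auto
      qed
      with u(2) show False by blast
    qed
  }
qed

section \<open>Eigenspaces of the perturbed operator\<close>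

lemma L2_subspace_eigenspace:
  assumes "L2_operator M D L"
  shows "L2_subspace M (eigenspace M D (perturbed L q) z)"
proof -
  have D: "L2_subspace M D"
    and cong: "\<And>u v. u \<in> D \<Longrightarrow> v \<in> D \<Longrightarrow> AE x in M. u x = v x \<Longrightarrow> AE x in M. L u x = L v x"
    and add: "\<And>u v. u \<in> D \<Longrightarrow> v \<in> D \<Longrightarrow> AE x in M. L (\<lambda>x. u x + v x) x = L u x + L v x"
    and scale: "\<And>c u. u \<in> D \<Longrightarrow> AE x in M. L (\<lambda>x. c * u x) x = c * L u x"
    using assms unfolding L2_operator_def by blast+
  have D0: "(\<lambda>x. 0) \<in> D"
    and Dadd: "\<And>u v. u \<in> D \<Longrightarrow> v \<in> D \<Longrightarrow> (\<lambda>x. u x + v x) \<in> D"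
    and Dscale: "\<And>c u. u \<in> D \<Longrightarrow> (\<lambda>x. c * u x) \<in> D"
    and Dcong: "\<And>u v. u \<in> D \<Longrightarrow> v \<in> L2 M \<Longrightarrow> AE x in M. v x = u x \<Longrightarrow> v \<in> D"
    and DL2: "D \<subseteq> L2 M"
    using D unfolding L2_subspace_def by blast+
  let ?E = "eigenspace M D (perturbed L q) z"
  have mem: "u \<in> ?E \<longleftrightarrow> u \<in> D \<and> (AE x in M. L u x + complex_of_real (q x) * u x = z * u x)" for u
    by (auto simp: eigenspace_def perturbed_def mult_op_def)
  \<comment> \<open>\<open>L\<close> maps the zero function to a null function by homogeneity with
    the scalar \<open>0\<close>.\<close>
  have "(\<lambda>x. 0) \<in> ?E"
    unfolding mem using D0 scale[OF D0, of 0] by simp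
  moreover have "(\<lambda>x. u x + v x) \<in> ?E" if uv: "u \<in> ?E" "v \<in> ?E" for u v
  proof -
    have "AE x in M. L (\<lambda>x. u x + v x) x = L u x + L v x" using uv by (simp add: mem add)
    moreover have "AE x in M. L u x + complex_of_real (q x) * u x = z * u x"
      "AE x in M. L v x + complex_of_real (q x) * v x = z * v x" using uv by (simp_all add: mem)
    ultimately have "AE x in M. L (\<lambda>x. u x + v x) x + complex_of_real (q x) * (u x + v x) = z * (u x + v x)"
      by eventually_elim (simp add: algebra_simps)
    then show ?thesis using uv by (simp add: mem Dadd)
  qed
  moreover have "(\<lambda>x. c * u x) \<in> ?E" if u: "u \<in> ?E" for c u
  proof -
    have "AE x in M. L (\<lambda>x. c * u x) x = c * L u x" using u by (simp add: mem scale)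
    moreover have "AE x in M. L u x + complex_of_real (q x) * u x = z * u x" using u by (simp add: mem)
    ultimately have "AE x in M. L (\<lambda>x. c * u x) x + complex_of_real (q x) * (c * u x) = z * (c * u x)"
    proof eventually_elim
      case (elim x)
      have "L (\<lambda>x. c * u x) x + complex_of_real (q x) * (c * u x) =
          c * (L u x + complex_of_real (q x) * u x)"
        by (simp add: elim(1) algebra_simps)
      then show ?case by (simp add: elim(2))
    qed
    then show ?thesis using u by (simp add: mem Dscale)
  qed
  moreover have "v \<in> ?E" if u: "u \<in> ?E" and v: "v \<in> L2 M" "AE x in M. v x = u x" for u v
  proof -
    have "v \<in> D" using Dcong[of u v] u v by (simp add: mem)
    moreover have "AE x in M. L v x = L u x" using cong[of v u] u v \<open>v \<in> D\<close> by (simp add: mem)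
    moreover have "AE x in M. L u x + complex_of_real (q x) * u x = z * u x" using u by (simp add: mem)
    with v(2) \<open>AE x in M. L v x = L u x\<close>
    have "AE x in M. L v x + complex_of_real (q x) * v x = z * v x" by eventually_elim simp
    ultimately show ?thesis by (simp add: mem)
  qed
  moreover have "?E \<subseteq> L2 M" using DL2 by (auto simp: mem)
  ultimately show ?thesis unfolding L2_subspace_def by blast
qed

theorem mainTheorem4:
  fixes B :: "'b::euclidean_space set"
    and \<A> :: "('a::{t2_space, second_countable_topology}, 'b) chart set"
    and \<mu> :: "'a measure"
    and \<omega> :: "'a set"
  assumes "smooth_manifold B \<A>"
    and "positive_smooth_density B \<A> \<mu>"
    and "open \<omega>" and "\<omega> \<noteq> {}" and "\<omega> \<subseteq> manifold_interior B \<A>"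
  shows
    "(\<forall>E n. L2_subspace \<mu> E \<and> L2_has_dim \<mu> E n \<and> 2 \<le> n \<longrightarrow>
        ((\<exists>\<sigma>\<in>Cc_smooth \<A> \<omega>. \<not> real_scalar_on \<mu> E (\<lambda>u. L2_proj \<mu> E (mult_op \<sigma> u)))
          \<longleftrightarrow> L2_restrict \<mu> \<omega> E \<noteq> L2_zero (restrict_space \<mu> \<omega>)))
     \<and>
     (\<forall>(\<T> :: 'q::real_vector topology) \<iota> D L q z E n.
        admissible_perturbation_space \<mu> \<T> \<iota> \<and>
        Cc_smooth \<A> \<omega> \<subseteq> perturbations \<mu> \<iota> \<and>
        self_adjoint \<mu> D L \<and>
        q \<in> perturbations \<mu> \<iota> \<and>
        E = eigenspace \<mu> D (perturbed L q) z \<and>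
        E \<noteq> L2_zero \<mu> \<and>
        L2_has_dim \<mu> E n \<and> 2 \<le> n \<longrightarrow>
        (L2_restrict \<mu> \<omega> E \<noteq> L2_zero (restrict_space \<mu> \<omega>) \<longrightarrow>
          (\<exists>\<sigma>\<in>Cc_smooth \<A> \<omega>. \<not> real_scalar_on \<mu> E (\<lambda>u. L2_proj \<mu> E (mult_op \<sigma> u)))) \<and>
        ((\<forall>u\<in>E. (AE x in \<mu>. x \<in> \<omega> \<longrightarrow> u x = 0) \<longrightarrow> (AE x in \<mu>. u x = 0)) \<longrightarrow>
          (\<exists>\<sigma>\<in>Cc_smooth \<A> \<omega>. \<not> real_scalar_on \<mu> E (\<lambda>u. L2_proj \<mu> E (mult_op \<sigma> u)))))"
proof -
  have S: "sets \<mu> = sets borel" using assms(2) by (simp add: positive_smooth_density_def)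
  note iff = ex_nonscalar_compression_iff[OF assms(1) S assms(3,5)]
  \<comment> \<open>Under unique continuation a vanishing restriction would make all of
    \<open>E\<close> null, against dimension at least two.\<close>
  have ucp: "L2_restrict \<mu> \<omega> E \<noteq> L2_zero (restrict_space \<mu> \<omega>)"
    if E: "L2_subspace \<mu> E" "L2_has_dim \<mu> E n" "2 \<le> n"
      and uc: "\<forall>u\<in>E. (AE x in \<mu>. x \<in> \<omega> \<longrightarrow> u x = 0) \<longrightarrow> (AE x in \<mu>. u x = 0)" for E n
  proof -
    have "(\<lambda>x. 0) \<in> E" using E(1) by (simp add: L2_subspace_def)
    \<comment> \<open>Orthogonality to the zero function is no constraint; the point is to obtain a
      non-null element of \<open>E\<close>.\<close>
    then obtain v where "v \<in> E" "\<not> (AE x in \<mu>. v x = 0)"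
      using L2_has_dim_ge_2_orthogonal[OF E] by blast
    with uc show ?thesis unfolding L2_restrict_eq_zero_iff[OF S assms(3) E(1)] by blast
  qed
  have sub: "L2_subspace \<mu> (eigenspace \<mu> D (perturbed L q) z)" if "self_adjoint \<mu> D L" for D L q z
    using that by (intro L2_subspace_eigenspace) (simp add: self_adjoint_def)
  show ?thesis
  proof (rule conjI; intro allI impI; elim conjE)
    fix E n
    assume "L2_subspace \<mu> E" "L2_has_dim \<mu> E n" "2 \<le> n"
    then show "(\<exists>\<sigma>\<in>Cc_smooth \<A> \<omega>. \<not> real_scalar_on \<mu> E (\<lambda>u. L2_proj \<mu> E (mult_op \<sigma> u))) \<longleftrightarrow>
        L2_restrict \<mu> \<omega> E \<noteq> L2_zero (restrict_space \<mu> \<omega>)"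
      by (rule iff)
  next
    fix \<T> :: "'q topology" and \<iota> D L q z E n
    assume sa: "self_adjoint \<mu> D L" and E_eq: "E = eigenspace \<mu> D (perturbed L q) z"
      and dim: "L2_has_dim \<mu> E n" "2 \<le> n"
    have E: "L2_subspace \<mu> E" unfolding E_eq by (rule sub[OF sa])
    show "(L2_restrict \<mu> \<omega> E \<noteq> L2_zero (restrict_space \<mu> \<omega>) \<longrightarrow>
          (\<exists>\<sigma>\<in>Cc_smooth \<A> \<omega>. \<not> real_scalar_on \<mu> E (\<lambda>u. L2_proj \<mu> E (mult_op \<sigma> u)))) \<and>
        ((\<forall>u\<in>E. (AE x in \<mu>. x \<in> \<omega> \<longrightarrow> u x = 0) \<longrightarrow> (AE x in \<mu>. u x = 0)) \<longrightarrow>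
          (\<exists>\<sigma>\<in>Cc_smooth \<A> \<omega>. \<not> real_scalar_on \<mu> E (\<lambda>u. L2_proj \<mu> E (mult_op \<sigma> u))))"
      \<comment> \<open>The equivalence replaces both existence claims by the nonvanishing of the
        restriction; the first implication becomes trivial and the second is
        \<open>ucp\<close>.\<close>
      unfolding iff[OF E dim] using ucp[OF E dim] by (intro conjI impI)
  qed
qed

end
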